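(* Let $P_D$ be a positive distribution over a set of discrete variables $U$. Let $D$ be a database with $N$ cases generated by $P_D$, where $N$ approximates infinity. Let $<_U$ be a total ordering on $U$. Let $B_S$ be the minimal I-map of $P_D$ that obeys $<_U$. Then, for any network structure $B_{S'}$ with $B_{S'}\neq B_S$ that obeys $<_U$, $$M(B_S,D)\gg M(B_{S'},D),$$ where $M$ is either the Bayesian measure or the MDL measure.
   Context: The source gives no formal definition of "$N$ approximates infinity" or of "$\gg$"; it explains the statement informally as saying that, for databases large enough, the minimal I-map obeying the ordering is overwhelmingly preferred (a network structure with a higher measure being preferred to one with a lower measure). $U=\{x_1,\dots,x_n\}$, where $x_i$ takes one of $r_i\ge 2$ values $v_{i1},\dots,v_{ir_i}$. A network structure over $U$ is a directed acyclic graph with one node for each variable in $U$; $\pi_i$ denotes the set of parents of $x_i$ in it. It obeys a total ordering $<_U$ on $U$ if $x_i<_U x_j$ for every arc $x_i\to x_j$ in it. A trail is a path that does not consider the direction of arcs; a head-to-head node in a trail is a node $e$ such that $x\to e\leftarrow y$ is part of the trail. A trail between $x$ and $y$ is blocked by a set of nodes $Z$ if at least one of the following holds: (i) it contains a head-to-head node $e$ such that $e\notin Z$ and no descendant of $e$ is in $Z$; (ii) it contains a node $e\in Z$ that is not a head-to-head node in the trail. $X$ is d-separated from $Y$ given $Z$ if every trail between any node of $X$ and any node of $Y$ is blocked by $Z$. For a joint distribution $P$ over $U$, $I(X,Z,Y)$ means that $P(XY|Z)=P(X|Z)P(Y|Z)$ for all values of the variables in $X$, $Y$, $Z$. A network structure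 is an I-map of $P$ if $X$ and $Y$ being d-separated by $Z$ in it implies that $I(X,Z,Y)$ holds in $P$. It is a minimal I-map of $P$ if it is an I-map and no arc can be removed from it without destroying this property. A database $D$ with $N$ cases consists of $N$ cases, each specifying a value for each variable in $U$ (no missing values); cases occur independently. For a network structure $B_S$, let $w_{ij}$, $j=1,\dots,q_i$ ($q_i\ge1$), denote the $j$th instantiation of $\pi_i$ relative to $D$. Let $N_{ijk}$ be the number of cases in $D$ in which $x_i$ has the value $v_{ik}$ and $\pi_i$ is instantiated as $w_{ij}$, and let $N_{ij}=\sum_{k=1}^{r_i}N_{ijk}$. $P(B_S)$ is the probability of $B_S$ prior to observation of the database. All logarithms are to base 2. The Bayesian measure of $B_S$ and $D$ is $$\log\Big(P(B_S)\prod_{i=1}^n\prod_{j=1}^{q_i}\frac{(r_i-1)!}{(N_{ij}+r_i-1)!}\prod_{k=1}^{r_i}N_{ijk}!\Big).$$ The MDL (minimum description length) measure of $B_S$ and $D$ is $$\log P(B_S)-N\cdot H(B_S,D)-\tfrac12\,\kappa\cdot\log N,$$ where $H(B_S,D)=\sum_{i=1}^n\sum_{j=1}^{q_i}\sum_{k=1}^{r_i}-\frac{N_{ijk}}{N}\log\frac{N_{ijk}}{N_{ij}}$ (with the usual convention $0\log 0=0$) and $\kappa=\sum_{i=1}^n(r_i-1)\prod_{x_j\in\pi_i}r_j$. *)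

theory Defs
  imports "HOL-Probability.Probability"
begin

section \<open>Network structures\<close>

text \<open>A network structure is represented by its set of arcs: a pair \<open>(x, y)\<close> stands for the
  arc \<open>x \<rightarrow> y\<close>. The nodes are the elements of the set \<open>U\<close> of variables.\<close>

definition network_structure :: "'v set \<Rightarrow> ('v \<times> 'v) set \<Rightarrow> bool" where
  "network_structure U B \<longleftrightarrow> B \<subseteq> U \<times> U \<and> acyclic B"

definition parents :: "('v \<times> 'v) set \<Rightarrow> 'v \<Rightarrow> 'v set" where
  "parents B x = {y. (y, x) \<in> B}"

definition obeys :: "('v \<times> 'v) set \<Rightarrow> ('v \<times> 'v) set \<Rightarrow> bool" where
  "obeys B ord \<longleftrightarrow> (\<forall>x y. (x, y) \<in> B \<longrightarrow> (x, y) \<in> ord)"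

section \<open>d-separation\<close>

definition trail :: "('v \<times> 'v) set \<Rightarrow> 'v list \<Rightarrow> bool" where
  "trail B p \<longleftrightarrow> p \<noteq> [] \<and> distinct p \<and> successively (\<lambda>x y. (x, y) \<in> B \<or> (y, x) \<in> B) p"

definition head_to_head :: "('v \<times> 'v) set \<Rightarrow> 'v list \<Rightarrow> 'v \<Rightarrow> bool" where
  "head_to_head B p e \<longleftrightarrow>
     (\<exists>p1 x y p2. p = p1 @ [x, e, y] @ p2 \<and> (x, e) \<in> B \<and> (y, e) \<in> B)"

definition blocked :: "('v \<times> 'v) set \<Rightarrow> 'v set \<Rightarrow> 'v list \<Rightarrow> bool" where
  "blocked B Z p \<longleftrightarrow>
     (\<exists>e. head_to_head B p e \<and> e \<notin> Z \<and> (\<forall>d. (e, d) \<in> B\<^sup>+ \<longrightarrow> d \<notin> Z)) \<or>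
     (\<exists>e\<in>set p. e \<in> Z \<and> \<not> head_to_head B p e)"

definition d_separated :: "('v \<times> 'v) set \<Rightarrow> 'v set \<Rightarrow> 'v set \<Rightarrow> 'v set \<Rightarrow> bool" where
  "d_separated B X Z Y \<longleftrightarrow>
     (\<forall>p. trail B p \<and> hd p \<in> X \<and> last p \<in> Y \<longrightarrow> blocked B Z p)"

section \<open>Independence and I-maps\<close>

text \<open>The set of values of a variable \<open>x\<close> is \<open>vals x\<close>. An instantiation of a set \<open>X\<close> of variables
  is an element of \<open>Pi\<^sub>E X vals\<close>, and a case is an instantiation of \<open>U\<close>. A joint distribution over
  \<open>U\<close> is a \<open>pmf\<close> on cases.\<close>

definition cond_indep ::
  "('v \<Rightarrow> 'b set) \<Rightarrow> ('v \<Rightarrow> 'b) pmf \<Rightarrow> 'v set \<Rightarrow> 'v set \<Rightarrow> 'v set \<Rightarrow> bool" where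
  "cond_indep vals P X Z Y \<longleftrightarrow>
     (\<forall>x\<in>Pi\<^sub>E X vals. \<forall>z\<in>Pi\<^sub>E Z vals. \<forall>y\<in>Pi\<^sub>E Y vals.
        \<P>(c in measure_pmf P. restrict c X = x \<and> restrict c Y = y \<bar> restrict c Z = z) =
        \<P>(c in measure_pmf P. restrict c X = x \<bar> restrict c Z = z) *
        \<P>(c in measure_pmf P. restrict c Y = y \<bar> restrict c Z = z))"

text \<open>As usual for d-separation, the three sets are taken pairwise disjoint.\<close>

definition I_map ::
  "'v set \<Rightarrow> ('v \<Rightarrow> 'b set) \<Rightarrow> ('v \<Rightarrow> 'b) pmf \<Rightarrow> ('v \<times> 'v) set \<Rightarrow> bool" where
  "I_map U vals P B \<longleftrightarrow>
     (\<forall>X Y Z. X \<subseteq> U \<and> Y \<subseteq> U \<and> Z \<subseteq> U \<and> X \<inter> Y = {} \<and> X \<inter> Z = {} \<and> Y \<inter> Z = {} \<and>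
        d_separated B X Z Y \<longrightarrow> cond_indep vals P X Z Y)"

definition minimal_I_map ::
  "'v set \<Rightarrow> ('v \<Rightarrow> 'b set) \<Rightarrow> ('v \<Rightarrow> 'b) pmf \<Rightarrow> ('v \<times> 'v) set \<Rightarrow> bool" where
  "minimal_I_map U vals P B \<longleftrightarrow>
     I_map U vals P B \<and> (\<forall>a\<in>B. \<not> I_map U vals P (B - {a}))"

section \<open>Measures of a network structure and a database\<close>

text \<open>A database is a list of cases. The instantiations of the parents of \<open>x\<close> relative to a
  database are those that occur in it; they play the role of \<open>w\<^sub>i\<^sub>1, \<dots>, w\<^sub>i\<^sub>q\<close>, and
  \<open>N3 D B x w v\<close>, \<open>N2 vals D B x w\<close> are the counts \<open>N\<^sub>i\<^sub>j\<^sub>k\<close>, \<open>N\<^sub>i\<^sub>j\<close>.\<close>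

definition parent_insts :: "('v \<Rightarrow> 'b) list \<Rightarrow> ('v \<times> 'v) set \<Rightarrow> 'v \<Rightarrow> ('v \<Rightarrow> 'b) set" where
  "parent_insts D B x = (\<lambda>c. restrict c (parents B x)) ` set D"

definition N3 :: "('v \<Rightarrow> 'b) list \<Rightarrow> ('v \<times> 'v) set \<Rightarrow> 'v \<Rightarrow> ('v \<Rightarrow> 'b) \<Rightarrow> 'b \<Rightarrow> nat" where
  "N3 D B x w v = length (filter (\<lambda>c. c x = v \<and> restrict c (parents B x) = w) D)"

definition N2 ::
  "('v \<Rightarrow> 'b set) \<Rightarrow> ('v \<Rightarrow> 'b) list \<Rightarrow> ('v \<times> 'v) set \<Rightarrow> 'v \<Rightarrow> ('v \<Rightarrow> 'b) \<Rightarrow> nat" where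
  "N2 vals D B x w = (\<Sum>v\<in>vals x. N3 D B x w v)"

definition bayesian_measure ::
  "'v set \<Rightarrow> ('v \<Rightarrow> 'b set) \<Rightarrow> ('v \<times> 'v) set pmf \<Rightarrow> ('v \<times> 'v) set \<Rightarrow> ('v \<Rightarrow> 'b) list \<Rightarrow> real" where
  "bayesian_measure U vals prior B D =
     log 2 (pmf prior B *
       (\<Prod>x\<in>U. \<Prod>w\<in>parent_insts D B x.
          fact (card (vals x) - 1) / fact (N2 vals D B x w + card (vals x) - 1) *
          (\<Prod>v\<in>vals x. fact (N3 D B x w v))))"

text \<open>In the following sum the convention \<open>0 log 0 = 0\<close> holds because \<open>0 * log 2 0 = 0\<close>.\<close>

definition cond_entropy ::
  "'v set \<Rightarrow> ('v \<Rightarrow> 'b set) \<Rightarrow> ('v \<times> 'v) set \<Rightarrow> ('v \<Rightarrow> 'b) list \<Rightarrow> real" where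
  "cond_entropy U vals B D =
     (\<Sum>x\<in>U. \<Sum>w\<in>parent_insts D B x. \<Sum>v\<in>vals x.
        - (real (N3 D B x w v) / real (length D)) *
          log 2 (real (N3 D B x w v) / real (N2 vals D B x w)))"

definition num_params :: "'v set \<Rightarrow> ('v \<Rightarrow> 'b set) \<Rightarrow> ('v \<times> 'v) set \<Rightarrow> nat" where
  "num_params U vals B = (\<Sum>x\<in>U. (card (vals x) - 1) * (\<Prod>y\<in>parents B x. card (vals y)))"

definition mdl_measure ::
  "'v set \<Rightarrow> ('v \<Rightarrow> 'b set) \<Rightarrow> ('v \<times> 'v) set pmf \<Rightarrow> ('v \<times> 'v) set \<Rightarrow> ('v \<Rightarrow> 'b) list \<Rightarrow> real" where
  "mdl_measure U vals prior B D =
     log 2 (pmf prior B) - real (length D) * cond_entropy U vals B D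
       - 1 / 2 * real (num_params U vals B) * log 2 (real (length D))"

end

theory Submission
  imports Defs "HOL-Real_Asymp.Real_Asymp"
begin

text \<open>Up to a bounded error, both measures of a structure equal its maximal log-likelihood minus
  half its number of parameters times \<open>log N\<close> (Stirling's formula for the Bayesian measure). Divided
  by \<open>N\<close>, the log-likelihood of a structure obeying the ordering converges to a limit that, by Gibbs'
  inequality, is largest precisely when every variable is independent of its other predecessors
  given its parents. If that fails for the competing structure, it loses by an amount linear in
  \<open>N\<close>. If it holds, the competitor is an I-map by soundness of d-separation, and as \<open>P\<close> is positive,
  minimality forces it to contain the minimal I-map properly. It then has more parameters, and it
  remains to see that the gain in log-likelihood is \<open>o(log N)\<close>. Since this gain is at most quadratic
  in the deviations of the counts from their means, it suffices that almost surely these deviations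
  are \<open>o(sqrt (N log N))\<close>, which follows from Hoeffding's inequality by a blocking argument.\<close>

section \<open>Active trails\<close>

text \<open>The delicate competitor is the one that properly contains the minimal I-map. Its penalty
  is larger only by a possibly small multiple of \<open>log N\<close>, and a product of two
  deviations of size \<open>sqrt (N * log N)\<close>, divided by \<open>N\<close>, has that same
  order. So the deviations must be of strictly smaller order. A union bound over all
  \<open>N\<close> only gives a fixed constant in front of \<open>sqrt (N * log N)\<close>, and a
  bound in probability would not hold almost surely; this forces the blocks.

  Likelihoods see only each node with its parents, while I-maps speak of all trails. The bridge is
  the ordered Markov property, which for a positive distribution and a structure obeying the
  ordering is equivalent to being an I-map. Marginals and conditionals are treated for an arbitrary
  weight on cases, so that the same algebra serves the distribution and the counts of a database.
  Chance enters only through the deviation bound; everything built on it is deterministic.\<close>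

definition has_descendant_in :: "('v \<times> 'v) set \<Rightarrow> 'v set \<Rightarrow> 'v \<Rightarrow> bool" where
  "has_descendant_in B Z e \<longleftrightarrow> (\<exists>d. (e, d) \<in> B\<^sup>+ \<and> d \<in> Z)"

definition passes :: "('v \<times> 'v) set \<Rightarrow> 'v set \<Rightarrow> 'v \<Rightarrow> 'v \<Rightarrow> 'v \<Rightarrow> bool" where
  "passes B Z l e r \<longleftrightarrow>
     (if (l, e) \<in> B \<and> (r, e) \<in> B then e \<in> Z \<or> has_descendant_in B Z e else e \<notin> Z)"

text \<open>Recursion over consecutive triples makes the condition local: when trails are cut and
  spliced, only the node at the junction has to be examined.\<close>

fun interior_passes :: "('v \<times> 'v) set \<Rightarrow> 'v set \<Rightarrow> 'v list \<Rightarrow> bool" where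
  "interior_passes B Z (l # e # r # p) \<longleftrightarrow> passes B Z l e r \<and> interior_passes B Z (e # r # p)"
| "interior_passes B Z _ \<longleftrightarrow> True"

text \<open>An end of a trail is never a head-to-head node, so it blocks as soon as it lies in
  \<open>Z\<close>; hence the conditions on the two ends.\<close>

definition active :: "('v \<times> 'v) set \<Rightarrow> 'v set \<Rightarrow> 'v list \<Rightarrow> bool" where
  "active B Z p \<longleftrightarrow> hd p \<notin> Z \<and> last p \<notin> Z \<and> interior_passes B Z p"

text \<open>Only the trail is confined to \<open>V\<close>; descendants are still taken in all of
  \<open>B\<close>. Whether a node passes therefore does not change when a node is deleted from
  \<open>V\<close>.\<close>

definition d_connected :: "('v \<times> 'v) set \<Rightarrow> 'v set \<Rightarrow> 'v set \<Rightarrow> 'v \<Rightarrow> 'v \<Rightarrow> bool" where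
  "d_connected B V Z x y \<longleftrightarrow>
     (\<exists>p. trail B p \<and> set p \<subseteq> V \<and> active B Z p \<and> hd p = x \<and> last p = y)"

lemma passes_commute: "passes B Z l e r \<longleftrightarrow> passes B Z r e l"
  by (auto simp: passes_def)

lemma interior_passes_append:
  "interior_passes B Z (xs @ e # ys) \<longleftrightarrow> interior_passes B Z (xs @ [e]) \<and>
     interior_passes B Z (e # ys) \<and> (xs \<noteq> [] \<and> ys \<noteq> [] \<longrightarrow> passes B Z (last xs) e (hd ys))"
proof (induction xs rule: induct_list012)
  case (2 x)
  then show ?case by (cases ys) auto
next
  case (3 x y zs)
  then show ?case
    by (cases zs) simp_all
qed simp

lemma interior_passes_rev: "interior_passes B Z (rev p) \<longleftrightarrow> interior_passes B Z p"
proof (induction p rule: induct_list012)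
  case (3 x y zs)
  show ?case
    using 3(2)
    using interior_passes_append[of B Z "rev zs" y "[x]"] passes_commute[of B Z x y]
    by (cases zs) (auto simp: last_rev)
qed auto

lemma active_not_blocked:
  assumes "active B Z p"
  shows "\<not> blocked B Z p"
proof
  assume "blocked B Z p"
  then consider (collider) e where "head_to_head B p e" "e \<notin> Z" "\<not> has_descendant_in B Z e"
    | (other) e where "e \<in> set p" "e \<in> Z" "\<not> head_to_head B p e"
    by (auto simp: blocked_def has_descendant_in_def)
  then show False
  proof cases
    case collider
    then obtain p1 x y p2 where "p = (p1 @ [x]) @ e # y # p2" "(x, e) \<in> B" "(y, e) \<in> B"
      unfolding head_to_head_def by fastforce
    then have "passes B Z x e y"
      using assms interior_passes_append[of B Z "p1 @ [x]" e "y # p2"] by (simp add: active_def)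
    with collider \<open>(x, e) \<in> B\<close> \<open>(y, e) \<in> B\<close> show False
      by (auto simp: passes_def)
  next
    case other
    obtain p1 p2 where p: "p = p1 @ e # p2"
      using other(1) by (meson split_list)
    have ne: "p1 \<noteq> []" "p2 \<noteq> []"
      using assms other(2) p by (auto simp: active_def)
    have "p1 = butlast p1 @ [last p1]" "p2 = hd p2 # tl p2"
      using ne by simp_all
    then have p': "p = butlast p1 @ [last p1, e, hd p2] @ tl p2"
      using p by (metis append.assoc append_Cons append_Nil)
    have "passes B Z (last p1) e (hd p2)"
      using assms p ne interior_passes_append[of B Z p1 e p2] by (simp add: active_def)
    moreover have "\<not> ((last p1, e) \<in> B \<and> (hd p2, e) \<in> B)"
      using other(3) p' unfolding head_to_head_def by blast
    ultimately show False
      using other(2) by (simp add: passes_def)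
  qed
qed

section \<open>Closure properties of d-connection\<close>

lemma d_connected_sym: "d_connected B V Z x y \<Longrightarrow> d_connected B V Z y x"
proof -
  assume "d_connected B V Z x y"
  then obtain p where p: "trail B p" "set p \<subseteq> V" "active B Z p" "hd p = x" "last p = y"
    by (auto simp: d_connected_def)
  then have "trail B (rev p)"
    by (simp add: trail_def disj_commute)
  with p show ?thesis
    unfolding d_connected_def
    by (intro exI[of _ "rev p"]) (auto simp: active_def interior_passes_rev hd_rev last_rev)
qed

text \<open>A directed stretch leaving \<open>e\<close> runs either into a head-to-head node, which is in \<open>Z\<close> or
  has a descendant in \<open>Z\<close> as the trail is active, or to the end of the trail.\<close>

lemma has_descendant_in_along_trail:
  assumes "successively (\<lambda>x y. (x, y) \<in> B \<or> (y, x) \<in> B) (e # p)" "interior_passes B Z (e # p)"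
    "p \<noteq> []" "(e, hd p) \<in> B" "has_descendant_in B Z (last p)"
  shows "has_descendant_in B Z e"
  using assms
proof (induction p arbitrary: e)
  case (Cons m ps)
  have em: "(e, m) \<in> B"
    using Cons.prems(4) by simp
  have "m \<in> Z \<or> has_descendant_in B Z m"
  proof (cases ps)
    case Nil
    then show ?thesis using Cons.prems(5) by simp
  next
    case ps: (Cons m' ps')
    have "passes B Z e m m'"
      using Cons.prems(2) ps by simp
    show ?thesis
    proof (cases "(m', m) \<in> B")
      case True
      then show ?thesis
        using \<open>passes B Z e m m'\<close> em by (simp add: passes_def)
    next
      case False
      have "has_descendant_in B Z m"
      proof (rule Cons.IH)
        show "successively (\<lambda>x y. (x, y) \<in> B \<or> (y, x) \<in> B) (m # ps)"
          using Cons.prems(1) by simp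
        then show "(m, hd ps) \<in> B"
          using False ps by simp
        show "interior_passes B Z (m # ps)"
          using Cons.prems(2) ps by simp
        show "ps \<noteq> []" "has_descendant_in B Z (last ps)"
          using Cons.prems(5) ps by simp_all
      qed
      then show ?thesis by simp
    qed
  qed
  then show ?case
    using em r_into_trancl[OF em] trancl_into_trancl2[OF em]
    unfolding has_descendant_in_def by blast
qed simp

text \<open>Plain concatenation may visit a node twice. Instead the first trail is left at its first
  node \<open>e\<close> that lies on the second one, and the second is followed from there. All
  other interior nodes keep both neighbours, so only \<open>e\<close> has to be checked.\<close>

lemma d_connected_trans:
  assumes "d_connected B V Z x a" "d_connected B V Z a y" "has_descendant_in B Z a"
  shows "d_connected B V Z x y"
proof -
  obtain p where p: "trail B p" "set p \<subseteq> V" "active B Z p" "hd p = x" "last p = a"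
    using assms(1) by (auto simp: d_connected_def)
  obtain q where q: "trail B q" "set q \<subseteq> V" "active B Z q" "hd q = a" "last q = y"
    using assms(2) by (auto simp: d_connected_def)
  have "\<exists>z\<in>set p. z \<in> set q"
    using p q by (metis last_in_set hd_in_set trail_def)
  then obtain p1 e p2 where p': "p = p1 @ e # p2" "e \<in> set q" "\<forall>z\<in>set p1. z \<notin> set q"
    using split_list_first_prop[OF \<open>\<exists>z\<in>set p. z \<in> set q\<close>] by blast
  obtain q1 q2 where q': "q = q1 @ e # q2"
    using p'(2) by (meson split_list)
  have ip: "interior_passes B Z (p1 @ [e])" "interior_passes B Z (e # p2)"
       "p1 \<noteq> [] \<Longrightarrow> p2 \<noteq> [] \<Longrightarrow> passes B Z (last p1) e (hd p2)"
    using p(3) interior_passes_append[of B Z p1 e p2] by (auto simp: active_def p'(1))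
  have iq: "interior_passes B Z (e # q2)"
       "q1 \<noteq> [] \<Longrightarrow> q2 \<noteq> [] \<Longrightarrow> passes B Z (last q1) e (hd q2)"
    using q(3) interior_passes_append[of B Z q1 e q2] by (auto simp: active_def q')
  have ends: "x \<notin> Z" "a \<notin> Z" "y \<notin> Z"
    using p q by (auto simp: active_def)
  let ?adj = "\<lambda>x y. (x, y) \<in> B \<or> (y, x) \<in> B"
  have sp: "successively ?adj p" and sq: "successively ?adj q"
    using p(1) q(1) by (auto simp: trail_def)
  have se: "successively ?adj (e # p2)"
    using sp p'(1) by (auto simp: successively_append_iff)
  \<comment> \<open>If \<open>e\<close> becomes head-to-head, it is either \<open>a\<close> itself,
    or was already head-to-head on \<open>p\<close>, or \<open>p\<close> leaves it along an arc; in
    the last case it inherits a descendant in \<open>Z\<close> from further along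
    \<open>p\<close>.\<close>
  have mid: "passes B Z (last p1) e (hd q2)" if "p1 \<noteq> []" "q2 \<noteq> []"
  proof (cases "(last p1, e) \<in> B \<and> (hd q2, e) \<in> B")
    case True
    have "e \<in> Z \<or> has_descendant_in B Z e"
    proof (cases "p2 = []")
      case True
      then show ?thesis using p'(1) p(5) assms(3) by simp
    next
      case False
      show ?thesis
      proof (cases "(hd p2, e) \<in> B")
        case True
        then show ?thesis
          using ip(3)[OF that(1) False] \<open>(last p1, e) \<in> B \<and> _\<close> by (auto simp: passes_def)
      next
        case nb: False
        then have "(e, hd p2) \<in> B"
          using se False by (cases p2) auto
        then have "has_descendant_in B Z e"
          using has_descendant_in_along_trail[OF se ip(2) False] assms(3) p(5) p'(1) False by simp
        then show ?thesis by simp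
      qed
    qed
    with True show ?thesis by (simp add: passes_def)
  next
    case False
    \<comment> \<open>One of the two neighbours is not joined to \<open>e\<close> by an arc into
      \<open>e\<close>. On the trail from which that neighbour comes, \<open>e\<close> is the end
      \<open>a\<close> or not head-to-head, hence outside \<open>Z\<close>.\<close>
    have "e \<notin> Z"
    proof (cases "(last p1, e) \<in> B")
      case True
      then show ?thesis
        using False iq(2) that(2) q' q(4) ends by (cases "q1 = []") (auto simp: passes_def)
    next
      case False
      then show ?thesis
        using ip(3) that(1) p' p(5) ends by (cases "p2 = []") (auto simp: passes_def)
    qed
    with False show ?thesis by (auto simp: passes_def)
  qed
  define s where "s = p1 @ e # q2"
  have "interior_passes B Z s"
    unfolding s_def using interior_passes_append[of B Z p1 e q2] ip(1) iq(1) mid by blast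
  moreover have hl: "hd s = x" "last s = y"
    using p(4) q(5) by (cases p1; simp add: s_def p'(1) q')+
  ultimately have "active B Z s"
    using ends by (simp add: active_def)
  moreover have "trail B s"
    using p(1) q(1) p'(3) unfolding trail_def s_def p'(1) q'
    by (auto simp: successively_append_iff successively_Cons)
  moreover have "set s \<subseteq> V"
    using p(2) q(2) by (auto simp: s_def p'(1) q')
  ultimately show ?thesis
    using hl unfolding d_connected_def by blast
qed

lemma d_connected_mono: "d_connected B V Z x y \<Longrightarrow> V \<subseteq> V' \<Longrightarrow> d_connected B V' Z x y"
proof -
  assume *: "d_connected B V Z x y" "V \<subseteq> V'"
  then obtain p where "trail B p" "set p \<subseteq> V" "active B Z p" "hd p = x" "last p = y"
    by (auto simp: d_connected_def)
  with *(2) show ?thesis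
    unfolding d_connected_def by (intro exI[of _ p] conjI) simp_all
qed

text \<open>A larger \<open>Z\<close> can only open head-to-head nodes, and the one other node it
  could close is \<open>n\<close> itself.\<close>

lemma passes_insert: "passes B Z l e r \<Longrightarrow> n \<noteq> e \<Longrightarrow> passes B (insert n Z) l e r"
  unfolding passes_def has_descendant_in_def by (auto split: if_splits)

lemma interior_passes_insert:
  assumes "interior_passes B Z p" "n \<notin> set p"
  shows "interior_passes B (insert n Z) p"
  using assms
  by (induction B Z p rule: interior_passes.induct)
     (simp_all add: passes_insert)

lemma d_connected_insert:
  "d_connected B V Z x y \<Longrightarrow> n \<notin> V \<Longrightarrow> d_connected B V (insert n Z) x y"
proof -
  assume *: "d_connected B V Z x y" "n \<notin> V"
  then obtain p where p: "trail B p" "set p \<subseteq> V" "active B Z p" "hd p = x" "last p = y"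
    by (auto simp: d_connected_def)
  have "x \<in> V" "y \<in> V" "n \<notin> set p"
    using p * by (auto simp: trail_def)
  then have "active B (insert n Z) p"
    using p * by (auto simp: active_def interior_passes_insert)
  with p show ?thesis
    unfolding d_connected_def by blast
qed

lemma d_connected_refl: "x \<in> V \<Longrightarrow> x \<notin> Z \<Longrightarrow> d_connected B V Z x x"
  unfolding d_connected_def by (intro exI[of _ "[x]"]) (auto simp: trail_def active_def)

text \<open>The new arc leaves \<open>q\<close>, so \<open>q\<close> is not head-to-head on the
  prolonged trail; as the end of an active trail it lies outside \<open>Z\<close> and
  passes.\<close>

lemma d_connected_parent:
  assumes "d_connected B V Z q y" "(q, n) \<in> B" "(n, q) \<notin> B" "n \<notin> V" "n \<notin> Z"
  shows "d_connected B (insert n V) Z n y"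
proof -
  obtain p where p: "trail B p" "set p \<subseteq> V" "active B Z p" "hd p = q" "last p = y"
    using assms(1) by (auto simp: d_connected_def)
  then obtain ps where [simp]: "p = q # ps"
    by (cases p) (auto simp: trail_def)
  have "interior_passes B Z (n # p)"
    using p assms by (cases ps) (auto simp: active_def passes_def)
  then have "active B Z (n # p)"
    using p(3) assms(5) by (simp add: active_def)
  moreover have "trail B (n # p)"
    using p(1,2) assms(2,4) by (auto simp: trail_def)
  moreover have "set (n # p) \<subseteq> insert n V" "last (n # p) = y" "hd (n # p) = n"
    using p by auto
  ultimately show ?thesis
    unfolding d_connected_def by blast
qed

lemma d_connected_common_child:
  assumes "(q, n) \<in> B" "(q', n) \<in> B" "n \<in> Z" "q \<notin> Z" "q' \<notin> Z" "n \<in> V" "q \<in> V" "q' \<in> V"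
  shows "d_connected B V Z q q'"
proof (cases "q = q'")
  case True
  then show ?thesis using assms by (simp add: d_connected_refl)
next
  case False
  have "q \<noteq> n" "q' \<noteq> n"
    using assms by auto
  then have "trail B [q, n, q']" "active B Z [q, n, q']" "set [q, n, q'] \<subseteq> V"
    using assms False by (auto simp: trail_def active_def passes_def)
  then show ?thesis
    unfolding d_connected_def by (intro exI[of _ "[q, n, q']"] conjI) simp_all
qed

section \<open>Marginals and factorised independence\<close>

definition depends_on :: "(('v \<Rightarrow> 'b) \<Rightarrow> 'r) \<Rightarrow> 'v set \<Rightarrow> bool" where
  "depends_on f S \<longleftrightarrow> (\<forall>c c'. (\<forall>x\<in>S. c x = c' x) \<longrightarrow> f c = f c')"

lemma depends_onD: "depends_on f S \<Longrightarrow> (\<And>x. x \<in> S \<Longrightarrow> c x = c' x) \<Longrightarrow> f c = f c'"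
  by (simp add: depends_on_def)

lemma depends_on_mono: "depends_on f S \<Longrightarrow> S \<subseteq> T \<Longrightarrow> depends_on f T"
  unfolding depends_on_def by blast

lemma depends_on_mult:
  fixes f g :: "('v \<Rightarrow> 'b) \<Rightarrow> real"
  assumes "depends_on f S" "depends_on g S"
  shows "depends_on (\<lambda>c. f c * g c) S"
  unfolding depends_on_def
proof (intro allI impI)
  fix c c' :: "'v \<Rightarrow> 'b"
  assume *: "\<forall>x\<in>S. c x = c' x"
  have "f c = f c'" "g c = g c'"
    by (rule depends_onD[OF assms(1)] depends_onD[OF assms(2)]; use * in blast)+
  then show "f c * g c = f c' * g c'"
    by simp
qed

locale variables =
  fixes U :: "'v set" and vals :: "'v \<Rightarrow> 'b set"
  assumes finite_U: "finite U" and finite_vals: "\<And>x. x \<in> U \<Longrightarrow> finite (vals x)"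
begin

abbreviation cases :: "('v \<Rightarrow> 'b) set" where
  "cases \<equiv> Pi\<^sub>E U vals"

text \<open>The weight \<open>a\<close> will be \<open>pmf P\<close> or the counts of a database.
  Only the values of \<open>c\<close> on \<open>S\<close> are read, so a total function stands for
  an instantiation of \<open>S\<close>, and \<open>ratio\<close> below is the conditional
  distribution of \<open>x\<close> given \<open>S\<close>.\<close>

definition mass :: "(('v \<Rightarrow> 'b) \<Rightarrow> real) \<Rightarrow> 'v set \<Rightarrow> ('v \<Rightarrow> 'b) \<Rightarrow> real" where
  "mass a S c = (\<Sum>c' | c' \<in> cases \<and> (\<forall>x\<in>S. c' x = c x). a c')"

definition ratio :: "(('v \<Rightarrow> 'b) \<Rightarrow> real) \<Rightarrow> 'v \<Rightarrow> 'v set \<Rightarrow> ('v \<Rightarrow> 'b) \<Rightarrow> real" where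
  "ratio a x S c = mass a (insert x S) c / mass a S c"

lemma finite_cases: "finite cases"
  by (intro finite_PiE finite_U finite_vals)

lemma depends_on_mass: "depends_on (mass a S) S"
  unfolding depends_on_def mass_def by (auto intro!: sum.cong)

lemma mass_cong: "(\<And>x. x \<in> S \<Longrightarrow> c x = c' x) \<Longrightarrow> mass a S c = mass a S c'"
  by (rule depends_onD[OF depends_on_mass])

lemma depends_on_ratio: "depends_on (ratio a x S) (insert x S)"
proof -
  have "mass a (insert x S) c = mass a (insert x S) c'" "mass a S c = mass a S c'"
    if "\<forall>y\<in>insert x S. c y = c' y" for c c'
    by (rule mass_cong; use that in blast)+
  then show ?thesis
    unfolding depends_on_def ratio_def by metis
qed

lemma mass_pos:
  assumes "\<And>c. c \<in> cases \<Longrightarrow> a c > 0" "c \<in> Pi U vals" "S \<subseteq> U"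
  shows "mass a S c > 0"
  unfolding mass_def
proof (rule sum_pos)
  show "finite {c' \<in> cases. \<forall>x\<in>S. c' x = c x}"
    using finite_cases by simp
  have "restrict c U \<in> {c' \<in> cases. \<forall>x\<in>S. c' x = c x}"
    using assms by auto
  then show "{c' \<in> cases. \<forall>x\<in>S. c' x = c x} \<noteq> {}"
    by blast
qed (use assms in auto)

lemma mass_empty: "mass a {} c = sum a cases"
  by (simp add: mass_def)

lemma mass_sum_value:
  assumes "x \<in> U" "x \<notin> S"
  shows "(\<Sum>v\<in>vals x. mass a (insert x S) (c(x := v))) = mass a S c"
proof -
  let ?A = "{c' \<in> cases. \<forall>y\<in>S. c' y = c y}"
  have "mass a (insert x S) (c(x := v)) = (\<Sum>c' | c' \<in> ?A \<and> c' x = v. a c')" for v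
    unfolding mass_def using assms(2) by (intro sum.cong) auto
  then have "(\<Sum>v\<in>vals x. mass a (insert x S) (c(x := v))) =
      (\<Sum>v\<in>vals x. \<Sum>c' | c' \<in> ?A \<and> c' x = v. a c')"
    by simp
  also have "\<dots> = sum a ?A"
    using assms finite_cases finite_vals by (intro sum.group) auto
  finally show ?thesis
    by (simp add: mass_def)
qed

text \<open>Passes from sums over cases to sums over the indices \<open>j\<close> and
  \<open>k\<close> of the counts, that is, over instantiations of the parents and values of the
  variable.\<close>

lemma sum_cases_family:
  assumes "x \<in> U" "S \<subseteq> U" "x \<notin> S"
  shows "(\<Sum>c\<in>cases. a c * f (restrict c S) (c x)) =
    (\<Sum>w\<in>Pi\<^sub>E S vals. \<Sum>v\<in>vals x. mass a (insert x S) (w(x := v)) * f w v)"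
proof -
  have fin: "finite (Pi\<^sub>E S vals \<times> vals x)"
    using assms finite_U finite_vals by (intro finite_cartesian_product finite_PiE) (auto intro: finite_subset)
  have "(\<Sum>c\<in>cases. a c * f (restrict c S) (c x)) =
     (\<Sum>p\<in>Pi\<^sub>E S vals \<times> vals x. \<Sum>c | c \<in> cases \<and> (restrict c S, c x) = p. a c * f (restrict c S) (c x))"
    by (rule sum.group[symmetric]) (use assms fin finite_cases in \<open>auto simp: PiE_def Pi_def\<close>)
  also have "\<dots> = (\<Sum>(w, v)\<in>Pi\<^sub>E S vals \<times> vals x. mass a (insert x S) (w(x := v)) * f w v)"
  proof (intro sum.cong refl, clarify)
    fix w v assume w: "w \<in> Pi\<^sub>E S vals" and v: "v \<in> vals x"
    have iff: "restrict c S = w \<longleftrightarrow> (\<forall>y\<in>S. c y = w y)" for c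
      using w by (auto simp: PiE_def extensional_def restrict_def fun_eq_iff)
    have "{c \<in> cases. (restrict c S, c x) = (w, v)} =
        {c \<in> cases. \<forall>y\<in>insert x S. c y = (w(x := v)) y}"
      using assms(3) by (auto simp: iff)
    then show "(\<Sum>c | c \<in> cases \<and> (restrict c S, c x) = (w, v). a c * f (restrict c S) (c x)) =
        mass a (insert x S) (w(x := v)) * f w v"
      unfolding mass_def sum_distrib_right by (intro sum.cong) auto
  qed
  finally show ?thesis
    by (simp add: sum.cartesian_product)
qed

lemma sum_cases_parents:
  assumes "x \<in> U" "S \<subseteq> U" "x \<notin> S"
  shows "(\<Sum>w\<in>Pi\<^sub>E S vals. mass a S w) = sum a cases"
  using sum_cases_family[OF assms, of a "\<lambda>_ _. 1"] mass_sum_value[OF assms(1,3)] by simp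

text \<open>Replacing the conditional distribution of \<open>x\<close> given \<open>S\<close> by \<open>r\<close> does not change the total
  weight. With \<open>ln y \<le> y - 1\<close> this gives Gibbs' inequality, and also the cancellation of the
  first-order term in \<open>loglik_upper\<close>.\<close>

lemma sum_reweighted:
  assumes x: "x \<in> U" "S \<subseteq> U" "x \<notin> S"
    and r: "depends_on r (insert x S)" "\<And>c. c \<in> Pi U vals \<Longrightarrow> (\<Sum>v\<in>vals x. r (c(x := v))) = 1"
    and a: "\<And>c. c \<in> cases \<Longrightarrow> a c > 0"
  shows "(\<Sum>c\<in>cases. a c * (r c / ratio a x S c)) = sum a cases"
proof -
  let ?f = "\<lambda>c. r c / ratio a x S c"
  have cong: "?f c = ?f ((restrict c S)(x := c x))" for c
  proof -
    have "r c = r ((restrict c S)(x := c x))"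
      by (rule depends_onD[OF r(1)]) auto
    moreover have "ratio a x S c = ratio a x S ((restrict c S)(x := c x))"
      by (rule depends_onD[OF depends_on_ratio]) auto
    ultimately show ?thesis by simp
  qed
  have "(\<Sum>c\<in>cases. a c * ?f c) = (\<Sum>c\<in>cases. a c * ?f ((restrict c S)(x := c x)))"
    using cong by simp
  also have "\<dots> = (\<Sum>w\<in>Pi\<^sub>E S vals. \<Sum>v\<in>vals x. mass a (insert x S) (w(x := v)) * ?f (w(x := v)))"
    by (rule sum_cases_family[OF x])
  also have "\<dots> = (\<Sum>w\<in>Pi\<^sub>E S vals. mass a S w)"
  proof (rule sum.cong[OF refl])
    fix w assume w: "w \<in> Pi\<^sub>E S vals"
    show "(\<Sum>v\<in>vals x. mass a (insert x S) (w(x := v)) * ?f (w(x := v))) = mass a S w"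
    proof (cases "cases = {}")
      case True
      then show ?thesis by (simp add: mass_def)
    next
      case False
      then obtain d where d: "d \<in> cases" by blast
      \<comment> \<open>\<open>w\<close> is unspecified outside \<open>S\<close>; filling it up from
        a case gives a point of \<open>Pi U vals\<close>, where positivity and the normalisation of
        \<open>r\<close> apply. Nothing below reads the filled-in coordinates.\<close>
      define w' where "w' y = (if y \<in> S then w y else d y)" for y
      have w': "w' \<in> Pi U vals"
        using w d by (auto simp: w'_def)
      have eqw: "ratio a x S (w(x := v)) = ratio a x S (w'(x := v))" "r (w(x := v)) = r (w'(x := v))"
           "mass a (insert x S) (w(x := v)) = mass a (insert x S) (w'(x := v))"
           "mass a S w = mass a S w'" for v
        by (rule depends_onD[OF depends_on_ratio] depends_onD[OF r(1)]
            depends_onD[OF depends_on_mass]; auto simp: w'_def)+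
      have "mass a (insert x S) (w(x := v)) * ?f (w(x := v)) = mass a S w' * r (w'(x := v))"
        if v: "v \<in> vals x" for v
      proof -
        have wv: "w'(x := v) \<in> Pi U vals"
          using w' v by auto
        have "mass a (insert x S) (w'(x := v)) > 0" "mass a S (w'(x := v)) > 0"
          by (rule mass_pos; use a wv x in blast)+
        moreover have "mass a S (w'(x := v)) = mass a S w'"
          by (rule mass_cong) (use x in auto)
        ultimately show ?thesis
          unfolding eqw by (simp add: ratio_def)
      qed
      then have "(\<Sum>v\<in>vals x. mass a (insert x S) (w(x := v)) * ?f (w(x := v))) =
          mass a S w' * (\<Sum>v\<in>vals x. r (w'(x := v)))"
        by (simp add: sum_distrib_left)
      then show ?thesis
        using r(2)[OF w'] eqw(4) by simp
    qed
  qed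
  also have "\<dots> = sum a cases"
    by (rule sum_cases_parents[OF x])
  finally show ?thesis .
qed

lemma sum_ratio:
  assumes "x \<in> U" "S \<subseteq> U" "x \<notin> S" "c \<in> Pi U vals" "\<And>c. c \<in> cases \<Longrightarrow> a c > 0"
  shows "(\<Sum>v\<in>vals x. ratio a x S (c(x := v))) = 1"
proof -
  have "ratio a x S (c(x := v)) = mass a (insert x S) (c(x := v)) / mass a S c" for v
    unfolding ratio_def using assms(3) by (auto intro!: arg_cong2[where f="(/)"] mass_cong)
  then have "(\<Sum>v\<in>vals x. ratio a x S (c(x := v))) = mass a S c / mass a S c"
    using mass_sum_value[OF assms(1,3), of a c] by (simp add: sum_divide_distrib [symmetric])
  also have "\<dots> = 1"
    using mass_pos[of a c S] assms by auto
  finally show ?thesis .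
qed

text \<open>Independence without division. Since \<open>F\<close> and \<open>G\<close> need not be
  marginals, the conditional distribution of a new node can simply be multiplied into one of
  them.\<close>

definition indep_fac :: "(('v \<Rightarrow> 'b) \<Rightarrow> real) \<Rightarrow> 'v set \<Rightarrow> 'v set \<Rightarrow> 'v set \<Rightarrow> bool" where
  "indep_fac a X Z Y \<longleftrightarrow> (\<exists>F G. depends_on F (X \<union> Z) \<and> depends_on G (Y \<union> Z) \<and>
     (\<forall>c\<in>Pi U vals. mass a (X \<union> Y \<union> Z) c = F c * G c))"

lemma indep_fac_sym: "indep_fac a X Z Y \<Longrightarrow> indep_fac a Y Z X"
  unfolding indep_fac_def by (metis mult.commute Un_commute)

text \<open>That \<open>F'\<close> works for all \<open>S\<close> and \<open>G\<close> at once matters in \<open>indep_fac_cross\<close>, where marginals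
  over different sets must share their factors.\<close>

lemma factor_marginal:
  assumes "finite T" "T \<subseteq> U" "T \<inter> R = {}" "depends_on F (T \<union> R)"
  obtains F' where "depends_on F' R"
    "\<And>S G. S \<inter> T = {} \<Longrightarrow> depends_on G S \<Longrightarrow>
       (\<forall>c\<in>Pi U vals. mass a (T \<union> R \<union> S) c = F c * G c) \<Longrightarrow>
       (\<forall>c\<in>Pi U vals. mass a (R \<union> S) c = F' c * G c)"
proof -
  have "\<exists>F'. depends_on F' R \<and> (\<forall>S G. S \<inter> T = {} \<longrightarrow> depends_on G S \<longrightarrow>
       (\<forall>c\<in>Pi U vals. mass a (T \<union> R \<union> S) c = F c * G c) \<longrightarrow>
       (\<forall>c\<in>Pi U vals. mass a (R \<union> S) c = F' c * G c))"
    using assms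
  proof (induction T arbitrary: F rule: finite_induct)
    case empty
    then show ?case by auto
  next
    case (insert x T)
    define F1 where "F1 c = (\<Sum>v\<in>vals x. F (c(x := v)))" for c
    have "depends_on F1 (T \<union> R)"
      unfolding depends_on_def F1_def
      by (auto intro!: sum.cong depends_onD[OF insert.prems(3)])
    from insert.IH[OF _ _ this] insert.prems obtain F' where F': "depends_on F' R"
       "\<And>S G. S \<inter> T = {} \<Longrightarrow> depends_on G S \<Longrightarrow>
       (\<forall>c\<in>Pi U vals. mass a (T \<union> R \<union> S) c = F1 c * G c) \<Longrightarrow>
       (\<forall>c\<in>Pi U vals. mass a (R \<union> S) c = F' c * G c)"
      by auto
    show ?case
    proof (intro exI[of _ F'] conjI allI impI ballI)
      show "depends_on F' R" by fact
    next
      fix S :: "'v set" and G :: "('v \<Rightarrow> 'b) \<Rightarrow> real"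
      assume S: "S \<inter> insert x T = {}" and G: "depends_on G S"
        and fac: "\<forall>c\<in>Pi U vals. mass a (insert x T \<union> R \<union> S) c = F c * G c"
      have "mass a (T \<union> R \<union> S) c = F1 c * G c" if c: "c \<in> Pi U vals" for c
      proof -
        have "mass a (T \<union> R \<union> S) c = (\<Sum>v\<in>vals x. mass a (insert x (T \<union> R \<union> S)) (c(x := v)))"
          by (rule mass_sum_value[symmetric]) (use S insert in auto)
        also have "\<dots> = (\<Sum>v\<in>vals x. F (c(x := v)) * G c)"
        proof (rule sum.cong[OF refl])
          fix v assume v: "v \<in> vals x"
          have "c(x := v) \<in> Pi U vals"
            using c v by auto
          then have "mass a (insert x T \<union> R \<union> S) (c(x := v)) = F (c(x := v)) * G (c(x := v))"
            using fac by blast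
          moreover have "G (c(x := v)) = G c"
            by (rule depends_onD[OF G]) (use S in auto)
          ultimately show "mass a (insert x (T \<union> R \<union> S)) (c(x := v)) = F (c(x := v)) * G c"
            by simp
        qed
        finally show ?thesis
          by (simp add: F1_def sum_distrib_right)
      qed
      then show "mass a (R \<union> S) c = F' c * G c" if "c \<in> Pi U vals" for c
        using F'(2)[of S G] S G that by blast
    qed
  qed
  then show ?thesis
    using that by blast
qed

text \<open>The decomposition property of conditional independence: \<open>T\<close> occurs in the
  first factor only and is summed out of it.\<close>

lemma indep_fac_subset:
  assumes "indep_fac a (X \<union> T) Z Y" "T \<inter> (X \<union> Y \<union> Z) = {}" "X \<union> T \<union> Y \<union> Z \<subseteq> U"
  shows "indep_fac a X Z Y"
proof -
  obtain F G where FG: "depends_on F (X \<union> T \<union> Z)" "depends_on G (Y \<union> Z)"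
     "\<forall>c\<in>Pi U vals. mass a (X \<union> T \<union> Y \<union> Z) c = F c * G c"
    using assms(1) by (auto simp: indep_fac_def)
  have fin: "finite T"
    using assms(3) finite_U by (auto intro: finite_subset)
  have "X \<union> T \<union> Z = T \<union> (X \<union> Z)" "X \<union> T \<union> Y \<union> Z = T \<union> (X \<union> Z) \<union> (Y \<union> Z)"
    "X \<union> Y \<union> Z = X \<union> Z \<union> (Y \<union> Z)"
    by blast+
  note eq = this
  show ?thesis
  proof (rule factor_marginal[of T "X \<union> Z" F a])
    show "depends_on F (T \<union> (X \<union> Z))"
      using FG(1) by (simp add: eq(1))
  next
    fix F' assume F': "depends_on F' (X \<union> Z)"
      "\<And>S G. S \<inter> T = {} \<Longrightarrow> depends_on G S \<Longrightarrow>
       (\<forall>c\<in>Pi U vals. mass a (T \<union> (X \<union> Z) \<union> S) c = F c * G c) \<Longrightarrow>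
       (\<forall>c\<in>Pi U vals. mass a (X \<union> Z \<union> S) c = F' c * G c)"
    have "\<forall>c\<in>Pi U vals. mass a (X \<union> Z \<union> (Y \<union> Z)) c = F' c * G c"
      by (rule F'(2)) (use FG assms in \<open>auto simp: eq(2)\<close>)
    then show ?thesis
      unfolding indep_fac_def eq(3) using F'(1) FG(2) by blast
  qed (use assms fin in auto)
qed

text \<open>Summing out \<open>X\<close>, \<open>Y\<close> or both from \<open>F * G\<close> gives
  \<open>F' * G\<close>, \<open>F * G'\<close> and \<open>F' * G'\<close> with the same four
  factors, and both sides of the equation are their product.\<close>

lemma indep_fac_cross:
  assumes "indep_fac a X Z Y" "X \<inter> Y = {}" "X \<inter> Z = {}" "Y \<inter> Z = {}" "X \<union> Y \<union> Z \<subseteq> U"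
    and c: "c \<in> Pi U vals"
  shows "mass a (X \<union> Y \<union> Z) c * mass a Z c = mass a (X \<union> Z) c * mass a (Y \<union> Z) c"
proof -
  obtain F G where FG: "depends_on F (X \<union> Z)" "depends_on G (Y \<union> Z)"
     "\<forall>c\<in>Pi U vals. mass a (X \<union> Y \<union> Z) c = F c * G c"
    using assms(1) by (auto simp: indep_fac_def)
  have fin: "finite X" "finite Y"
    using assms(5) finite_U by (auto intro: finite_subset)
  have XsubU: "X \<subseteq> U" "Y \<subseteq> U"
    using assms(5) by auto
  show ?thesis
  proof (rule factor_marginal[OF fin(1) XsubU(1) assms(3) FG(1), of a])
    fix F' assume F': "depends_on F' Z"
      "\<And>S G. S \<inter> X = {} \<Longrightarrow> depends_on G S \<Longrightarrow>
       (\<forall>c\<in>Pi U vals. mass a (X \<union> Z \<union> S) c = F c * G c) \<Longrightarrow>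
       (\<forall>c\<in>Pi U vals. mass a (Z \<union> S) c = F' c * G c)"
    show ?thesis
    proof (rule factor_marginal[OF fin(2) XsubU(2) assms(4) FG(2), of a])
      fix G' assume G': "depends_on G' Z"
        "\<And>S F. S \<inter> Y = {} \<Longrightarrow> depends_on F S \<Longrightarrow>
         (\<forall>c\<in>Pi U vals. mass a (Y \<union> Z \<union> S) c = G c * F c) \<Longrightarrow>
         (\<forall>c\<in>Pi U vals. mass a (Z \<union> S) c = G' c * F c)"
      have "X \<union> Y \<union> Z = X \<union> Z \<union> (Y \<union> Z)" "X \<union> Y \<union> Z = Y \<union> Z \<union> (X \<union> Z)"
        by blast+
      note eq = this
      have yz: "\<forall>c\<in>Pi U vals. mass a (Z \<union> (Y \<union> Z)) c = F' c * G c"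
        by (rule F'(2)) (use FG assms in \<open>auto simp: eq(1)[symmetric]\<close>)
      have xz: "\<forall>c\<in>Pi U vals. mass a (Z \<union> (X \<union> Z)) c = G' c * F c"
        by (rule G'(2)) (use FG assms in \<open>auto simp: eq(2)[symmetric] mult.commute\<close>)
      have z: "\<forall>c\<in>Pi U vals. mass a (Z \<union> Z) c = F' c * G' c"
      proof (rule F'(2))
        have "\<forall>c\<in>Pi U vals. mass a (X \<union> Z \<union> Z) c = G' c * F c"
          using xz by (simp add: Un_ac)
        then show "\<forall>c\<in>Pi U vals. mass a (X \<union> Z \<union> Z) c = F c * G' c"
          by (simp add: mult.commute)
      qed (use assms G'(1) in auto)
      have "mass a (X \<union> Z) c = G' c * F c" "mass a (Y \<union> Z) c = F' c * G c" "mass a Z c = F' c * G' c"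
        using xz yz z c by (simp_all add: Un_ac)
      then show ?thesis
        using FG(3) c by simp
    qed
  qed
qed

text \<open>\<open>g\<close> does not involve \<open>R\<close>, so it survives summing
  \<open>R\<close> out one variable at a time. A conditional distribution given
  \<open>S \<union> R\<close> that reads only \<open>S\<close> is thus the one given
  \<open>S\<close>.\<close>

lemma mass_sub_factor:
  assumes "finite R" "S \<inter> R = {}" "n \<notin> S \<union> R" "S \<union> R \<subseteq> U"
    and g: "depends_on g (insert n S)"
    and fac: "\<forall>c\<in>Pi U vals. mass a (insert n (S \<union> R)) c = mass a (S \<union> R) c * g c"
  shows "\<forall>c\<in>Pi U vals. mass a (insert n S) c = mass a S c * g c"
  using assms
proof (induction R rule: finite_induct)
  case (insert x R)
  have "mass a (insert n (S \<union> R)) c = mass a (S \<union> R) c * g c" if c: "c \<in> Pi U vals" for c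
  proof -
    have "mass a (insert n (S \<union> R)) c = (\<Sum>v\<in>vals x. mass a (insert x (insert n (S \<union> R))) (c(x := v)))"
      by (rule mass_sum_value[symmetric]) (use insert in auto)
    also have "\<dots> = (\<Sum>v\<in>vals x. mass a (insert x (S \<union> R)) (c(x := v)) * g c)"
    proof (rule sum.cong[OF refl])
      fix v assume v: "v \<in> vals x"
      have "c(x := v) \<in> Pi U vals"
        using c v by auto
      then have "mass a (insert n (S \<union> insert x R)) (c(x := v)) =
          mass a (S \<union> insert x R) (c(x := v)) * g (c(x := v))"
        using insert.prems(5) by blast
      moreover have "g (c(x := v)) = g c"
        by (rule depends_onD[OF g]) (use insert in auto)
      ultimately show "mass a (insert x (insert n (S \<union> R))) (c(x := v)) =
          mass a (insert x (S \<union> R)) (c(x := v)) * g c"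
        by (simp add: insert_commute)
    qed
    also have "\<dots> = mass a (S \<union> R) c * g c"
      unfolding sum_distrib_right[symmetric]
      by (subst mass_sum_value) (use insert in auto)
    finally show ?thesis .
  qed
  then show ?case
    using insert by auto
qed simp

end

section \<open>Soundness of d-separation\<close>

locale ordered_variables = variables U vals for U :: "'v set" and vals :: "'v \<Rightarrow> 'b set" +
  fixes ord :: "('v \<times> 'v) set"
  assumes ord: "strict_linear_order_on U ord"
begin

definition pred :: "'v \<Rightarrow> 'v set" where
  "pred x = {y \<in> U. (y, x) \<in> ord}"

text \<open>The ordered Markov property, written as an equality of conditional distributions because
  both the factorisation arguments and Gibbs' inequality work with these.\<close>

definition locally_markov :: "(('v \<Rightarrow> 'b) \<Rightarrow> real) \<Rightarrow> ('v \<times> 'v) set \<Rightarrow> bool" where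
  "locally_markov a B \<longleftrightarrow>
     (\<forall>x\<in>U. \<forall>c\<in>Pi U vals. ratio a x (pred x) c = ratio a x (parents B x) c)"

lemma ord_trans: "(x, y) \<in> ord \<Longrightarrow> (y, z) \<in> ord \<Longrightarrow> (x, z) \<in> ord"
  and ord_irrefl: "(x, x) \<notin> ord"
  and ord_total: "x \<in> U \<Longrightarrow> y \<in> U \<Longrightarrow> x \<noteq> y \<Longrightarrow> (x, y) \<in> ord \<or> (y, x) \<in> ord"
  using ord unfolding strict_linear_order_on_def
  by (auto simp: irrefl_def total_on_def dest: transD)

lemma ord_asym: "(x, y) \<in> ord \<Longrightarrow> (y, x) \<notin> ord"
  using ord_trans ord_irrefl by blast

lemma pred_subset: "pred x \<subseteq> U" and not_in_pred: "x \<notin> pred x"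
  by (auto simp: pred_def ord_irrefl)

lemma pred_pred: "y \<in> pred x \<Longrightarrow> pred y \<subseteq> pred x"
  using ord_trans by (auto simp: pred_def)

lemma parents_subset_pred:
  "network_structure U B \<Longrightarrow> obeys B ord \<Longrightarrow> parents B x \<subseteq> pred x"
  by (auto simp: network_structure_def obeys_def parents_def pred_def)

lemma descendant_later: "obeys B ord \<Longrightarrow> (x, y) \<in> B\<^sup>+ \<Longrightarrow> (x, y) \<in> ord"
  by (erule trancl_induct) (auto simp: obeys_def intro: ord_trans)

lemma initial_segment_last:
  assumes "finite V" "V \<subseteq> U" "\<And>x. x \<in> V \<Longrightarrow> pred x \<subseteq> V" "V \<noteq> {}"
  obtains n where "n \<in> V" "V = insert n (pred n)"
proof -
  have "\<exists>n\<in>V. \<forall>y\<in>V. y \<noteq> n \<longrightarrow> (y, n) \<in> ord"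
    using assms(1,4,2)
  proof (induction rule: finite_ne_induct)
    case (insert x F)
    then obtain n where n: "n \<in> F" "\<forall>y\<in>F. y \<noteq> n \<longrightarrow> (y, n) \<in> ord"
      by auto
    have "x \<noteq> n"
      using insert n by auto
    then consider "(x, n) \<in> ord" | "(n, x) \<in> ord"
      using ord_total[of x n] insert.prems n by auto
    then show ?case
    proof cases
      case 1
      with n show ?thesis by auto
    next
      case 2
      have "(y, x) \<in> ord" if "y \<in> F" for y
        using n 2 ord_trans[of y n x] that by (cases "y = n") auto
      then show ?thesis by auto
    qed
  qed simp
  then obtain n where n: "n \<in> V" "\<forall>y\<in>V. y \<noteq> n \<longrightarrow> (y, n) \<in> ord"
    by blast
  then have "V = insert n (pred n)"
    using assms(2) assms(3)[OF n(1)] by (auto simp: pred_def)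
  with n show ?thesis
    using that by blast
qed

context
  fixes a :: "('v \<Rightarrow> 'b) \<Rightarrow> real" and B :: "('v \<times> 'v) set"
  assumes a_pos: "\<And>c. c \<in> cases \<Longrightarrow> a c > 0"
    and B: "network_structure U B" "obeys B ord"
begin

lemma mass_insert_last:
  assumes lm: "locally_markov a B" and n: "n \<in> U"
    and S: "parents B n \<subseteq> S" "S \<subseteq> pred n" and c: "c \<in> Pi U vals"
  shows "mass a (insert n S) c = mass a S c * ratio a n (parents B n) c"
proof -
  have "\<forall>c\<in>Pi U vals. mass a (insert n S) c = mass a S c * ratio a n (parents B n) c"
  proof (rule mass_sub_factor[where R = "pred n - S"])
    show "depends_on (ratio a n (parents B n)) (insert n S)"
      by (rule depends_on_mono[OF depends_on_ratio]) (use S in auto)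
    have un: "S \<union> (pred n - S) = pred n"
      using S by auto
    show "\<forall>c\<in>Pi U vals. mass a (insert n (S \<union> (pred n - S))) c =
        mass a (S \<union> (pred n - S)) c * ratio a n (parents B n) c"
    proof
      fix c assume c: "c \<in> Pi U vals"
      have "mass a (pred n) c > 0"
        by (rule mass_pos) (use a_pos c pred_subset in auto)
      moreover have "ratio a n (pred n) c = ratio a n (parents B n) c"
        using lm n c by (simp add: locally_markov_def)
      ultimately show "mass a (insert n (S \<union> (pred n - S))) c =
          mass a (S \<union> (pred n - S)) c * ratio a n (parents B n) c"
        unfolding un by (simp add: ratio_def field_simps)
    qed
    show "finite (pred n - S)"
      using pred_subset[of n] finite_U finite_subset by blast
  qed (use S n pred_subset[of n] not_in_pred[of n] in auto)
  then show ?thesis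
    using c by blast
qed

text \<open>The conditional distribution of \<open>n\<close> reads only \<open>n\<close> and
  \<open>X \<union> Z\<close>, so \<open>F\<close> absorbs it. Whether \<open>n\<close> is then
  counted to \<open>X\<close> or to \<open>Z\<close> makes no difference to the factors.\<close>

lemma indep_fac_add_last:
  assumes lm: "locally_markov a B" and n: "n \<in> U"
    and sub: "X \<union> Y \<union> Z \<subseteq> pred n" "parents B n \<subseteq> X \<union> Z" and ind: "indep_fac a X Z Y"
  shows "indep_fac a (insert n X) Z Y" "indep_fac a X (insert n Z) Y"
proof -
  obtain F G where FG: "depends_on F (X \<union> Z)" "depends_on G (Y \<union> Z)"
     "\<forall>c\<in>Pi U vals. mass a (X \<union> Y \<union> Z) c = F c * G c"
    using ind by (auto simp: indep_fac_def)
  let ?F = "\<lambda>c. F c * ratio a n (parents B n) c"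
  have F: "depends_on ?F (insert n (X \<union> Z))"
  proof (rule depends_on_mult)
    show "depends_on F (insert n (X \<union> Z))"
      by (rule depends_on_mono[OF FG(1)]) auto
    show "depends_on (ratio a n (parents B n)) (insert n (X \<union> Z))"
      by (rule depends_on_mono[OF depends_on_ratio]) (use sub in auto)
  qed
  have "mass a (insert n (X \<union> Y \<union> Z)) c = ?F c * G c" if "c \<in> Pi U vals" for c
  proof -
    have "parents B n \<subseteq> X \<union> Y \<union> Z"
      using sub(2) by auto
    from mass_insert_last[OF lm n this sub(1) that] FG(3) that show ?thesis
      by simp
  qed
  then have fac: "\<forall>c\<in>Pi U vals. mass a (insert n (X \<union> Y \<union> Z)) c = ?F c * G c"
    by blast
  have G: "depends_on G (Y \<union> insert n Z)"
    by (rule depends_on_mono[OF FG(2)]) auto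
  show "indep_fac a (insert n X) Z Y"
    unfolding indep_fac_def
    by (rule exI[of _ ?F], rule exI[of _ G]) (use F FG(2) fac in simp)
  show "indep_fac a X (insert n Z) Y"
    unfolding indep_fac_def
    by (rule exI[of _ ?F], rule exI[of _ G]) (use F G fac in simp)
qed

text \<open>Undoes the removal of the last node: with its parents temporarily added to
  \<open>X\<close>, the factor of \<open>n\<close> can be absorbed, and the parents that do not
  belong to \<open>X\<close> are summed out afterwards.\<close>

lemma indep_fac_join_parents:
  assumes lm: "locally_markov a B" and n: "n \<in> U" "n \<in> X \<union> Z" "n \<notin> Y"
    and sub: "X \<union> Y \<union> Z \<subseteq> insert n (pred n)"
    and disj: "X \<inter> Y = {}" "X \<inter> Z = {}" "Y \<inter> Z = {}"
    and ind: "indep_fac a ((X - {n}) \<union> (parents B n - Z)) (Z - {n}) Y"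
    and QY: "(parents B n - Z) \<inter> Y = {}"
  shows "indep_fac a X Z Y"
proof -
  let ?Q = "parents B n - Z"
  have pa: "parents B n \<subseteq> pred n"
    by (rule parents_subset_pred[OF B])
  then have nQ: "n \<notin> parents B n"
    using not_in_pred by auto
  let ?X2 = "(X - {n}) \<union> ?Q" and ?Z1 = "Z - {n}"
  have s: "?X2 \<union> Y \<union> ?Z1 \<subseteq> pred n" "parents B n \<subseteq> ?X2 \<union> ?Z1"
    using sub pa n nQ by auto
  note add = indep_fac_add_last[OF lm n(1) s ind]
  have "indep_fac a (X \<union> (?Q - X)) Z Y"
  proof (cases "n \<in> X")
    case True
    then have "insert n ?X2 = X \<union> (?Q - X)" "?Z1 = Z"
      using disj by auto
    with add(1) show ?thesis by simp
  next
    case False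
    then have "?X2 = X \<union> (?Q - X)" "insert n ?Z1 = Z"
      using n by auto
    with add(2) show ?thesis by simp
  qed
  then show ?thesis
    by (rule indep_fac_subset) (use QY sub n pa pred_subset[of n] in blast)+
qed

text \<open>Soundness of d-separation, by removing the last node of an initial segment. If that node is
  in \<open>X\<close> or \<open>Y\<close>, its parents join its side. If it is in \<open>Z\<close>, it makes its parents mutually
  d-connected, so they cannot be d-connected to both \<open>X\<close> and \<open>Y\<close> and join one of the two sides.\<close>

lemma d_separation_sound:
  assumes lm: "locally_markov a B"
    and V: "V \<subseteq> U" "\<And>x. x \<in> V \<Longrightarrow> pred x \<subseteq> V"
    and sub: "X \<union> Y \<union> Z \<subseteq> V" and disj: "X \<inter> Y = {}" "X \<inter> Z = {}" "Y \<inter> Z = {}"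
    and sep: "\<And>x y. x \<in> X \<Longrightarrow> y \<in> Y \<Longrightarrow> \<not> d_connected B V Z x y"
  shows "indep_fac a X Z Y"
  using V sub disj sep
proof (induction "card V" arbitrary: V X Y Z rule: less_induct)
  case less
  have finV: "finite V"
    using less.prems(1) finite_U finite_subset by blast
  show ?case
  proof (cases "V = {}")
    case True
    then have e: "X = {}" "Y = {}" "Z = {}"
      using less.prems by auto
    show ?thesis
      unfolding indep_fac_def e
      by (rule exI[of _ "\<lambda>_. sum a cases"], rule exI[of _ "\<lambda>_. 1"])
         (simp add: depends_on_def mass_empty)
  next
    case False
    obtain n where n: "n \<in> V" "V = insert n (pred n)"
      using initial_segment_last[OF finV less.prems(1,2) False] by blast
    have nU: "n \<in> U"
      using n less.prems(1) by blast
    have pa: "parents B n \<subseteq> pred n"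
      by (rule parents_subset_pred[OF B])
    have nn: "n \<notin> pred n"
      by (rule not_in_pred)
    have card: "card (pred n) < card V"
      using n nn finV by (intro psubset_card_mono) auto
    have IH: "indep_fac a X' Z' Y'"
      if "X' \<union> Y' \<union> Z' \<subseteq> pred n" "X' \<inter> Y' = {}" "X' \<inter> Z' = {}" "Y' \<inter> Z' = {}"
        "\<And>x y. x \<in> X' \<Longrightarrow> y \<in> Y' \<Longrightarrow> \<not> d_connected B (pred n) Z' x y" for X' Y' Z'
      by (rule less.hyps[OF card]) (use that pred_subset pred_pred in blast)+
    have mono: "d_connected B V Z' x y" if "d_connected B (pred n) Z' x y" for Z' x y
      using d_connected_mono[OF that] n by blast
    have join: "indep_fac a X Z Y"
      if "n \<in> X \<union> Z" "n \<notin> Y" "X \<union> Y \<union> Z \<subseteq> V" "X \<inter> Y = {}" "X \<inter> Z = {}" "Y \<inter> Z = {}"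
        and s: "\<And>x y. x \<in> (X - {n}) \<union> (parents B n - Z) \<Longrightarrow> y \<in> Y \<Longrightarrow>
              \<not> d_connected B (pred n) (Z - {n}) x y" for X Y Z
    proof (rule indep_fac_join_parents[OF lm nU that(1,2)])
      show QY: "(parents B n - Z) \<inter> Y = {}"
      proof (rule ccontr)
        assume "(parents B n - Z) \<inter> Y \<noteq> {}"
        then obtain q where q: "q \<in> parents B n - Z" "q \<in> Y" by blast
        have "d_connected B (pred n) (Z - {n}) q q"
          by (rule d_connected_refl) (use q pa in auto)
        with s[of q q] q show False by blast
      qed
      show "indep_fac a (X - {n} \<union> (parents B n - Z)) (Z - {n}) Y"
      proof (rule IH)
        show "X - {n} \<union> (parents B n - Z) \<union> Y \<union> (Z - {n}) \<subseteq> pred n"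
          using that n pa by auto
        show "(X - {n} \<union> (parents B n - Z)) \<inter> Y = {}"
          using that QY by auto
        show "(X - {n} \<union> (parents B n - Z)) \<inter> (Z - {n}) = {}" "Y \<inter> (Z - {n}) = {}"
          using that by auto
      qed (rule s)
    qed (use that(3-6) n(2) in auto)
    have in_X: "indep_fac a X Z Y"
      if "n \<in> X" "X \<union> Y \<union> Z \<subseteq> V" "X \<inter> Y = {}" "X \<inter> Z = {}" "Y \<inter> Z = {}"
        and s: "\<And>x y. x \<in> X \<Longrightarrow> y \<in> Y \<Longrightarrow> \<not> d_connected B V Z x y" for X Y Z
    proof (rule join)
      fix x y assume x: "x \<in> X - {n} \<union> (parents B n - Z)" and y: "y \<in> Y"
      have Z: "Z - {n} = Z" "n \<notin> Z"
        using that by auto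
      show "\<not> d_connected B (pred n) (Z - {n}) x y"
      proof
        assume d: "d_connected B (pred n) (Z - {n}) x y"
        show False
        proof (cases "x \<in> X")
          case True
          then show False using mono[OF d] s[OF True y] Z(1) by simp
        next
          \<comment> \<open>Here \<open>x\<close> is a parent of \<open>n\<close>, so the trail can
            be prolonged to start at \<open>n\<close>, which is in \<open>X\<close>.\<close>
          case False
          then have xn: "(x, n) \<in> B" "x \<in> pred n"
            using x pa by (auto simp: parents_def)
          have "(n, x) \<notin> B"
            using B(2) xn(1) ord_asym unfolding obeys_def by blast
          then have "d_connected B (insert n (pred n)) Z n y"
            using d_connected_parent[OF _ xn(1) _ nn Z(2)] d Z(1) by simp
          then show False
            using s[OF that(1) y] unfolding n(2)[symmetric] by argo
        qed
      qed
    qed (use that(1-5) in auto)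
    have in_Z: "indep_fac a X Z Y"
      if "n \<in> Z" "X \<union> Y \<union> Z \<subseteq> V" "X \<inter> Y = {}" "X \<inter> Z = {}" "Y \<inter> Z = {}"
        and s: "\<And>x y. x \<in> X \<Longrightarrow> y \<in> Y \<Longrightarrow> \<not> d_connected B V Z x y"
        and q: "\<And>q y. q \<in> parents B n - Z \<Longrightarrow> y \<in> Y \<Longrightarrow> \<not> d_connected B V Z q y" for X Y Z
    proof (rule join)
      fix x y assume x: "x \<in> X - {n} \<union> (parents B n - Z)" and y: "y \<in> Y"
      show "\<not> d_connected B (pred n) (Z - {n}) x y"
      proof
        assume d: "d_connected B (pred n) (Z - {n}) x y"
        \<comment> \<open>The trail stays inside \<open>pred n\<close> and hence avoids
          \<open>n\<close>, so it remains active when \<open>n\<close> is put back into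
          \<open>Z\<close>.\<close>
        have "d_connected B V Z x y"
          using mono[OF d_connected_insert[OF d nn]] that(1) by (simp add: insert_absorb)
        moreover have "x \<in> X \<or> x \<in> parents B n - Z"
          using x by blast
        ultimately show False
          using s[OF _ y, of x] q[OF _ y, of x] by argo
      qed
    qed (use that(1-5) in auto)
    consider "n \<notin> X \<union> Y \<union> Z" | "n \<in> X" | "n \<in> Y" | "n \<in> Z" by blast
    then show ?thesis
    proof cases
      case 1
      show ?thesis
      proof (rule IH)
        show "X \<union> Y \<union> Z \<subseteq> pred n"
          using 1 less.prems(3) n(2) by auto
        show "\<not> d_connected B (pred n) Z x y" if "x \<in> X" "y \<in> Y" for x y
          using less.prems(7)[OF that] mono[of Z x y] by argo
      qed (fact less.prems)+
    next
      case 2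
      then show ?thesis
        by (rule in_X) (fact less.prems)+
    next
      case 3
      have "indep_fac a Y Z X"
        using 3
      proof (rule in_X)
        fix y x assume yx: "y \<in> Y" "x \<in> X"
        show "\<not> d_connected B V Z y x"
          using less.prems(7)[OF yx(2,1)] by (rule contrapos_nn) (rule d_connected_sym)
      qed (use less.prems(3-6) in auto)
      then show ?thesis
        by (rule indep_fac_sym)
    next
      case 4
      \<comment> \<open>Otherwise there is a connection from \<open>x\<close> to \<open>q'\<close>,
        over the head-to-head node \<open>n\<close> to \<open>q\<close>, and on to \<open>y\<close>.
        It can be spliced at \<open>q'\<close> and \<open>q\<close> because both have the descendant
        \<open>n\<close> in \<open>Z\<close>.\<close>
      have "(\<forall>q\<in>parents B n - Z. \<forall>y\<in>Y. \<not> d_connected B V Z q y) \<or>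
            (\<forall>q\<in>parents B n - Z. \<forall>x\<in>X. \<not> d_connected B V Z q x)"
      proof (rule ccontr)
        assume "\<not> ?thesis"
        then obtain q y q' x where q: "q \<in> parents B n - Z" "y \<in> Y" "d_connected B V Z q y"
           "q' \<in> parents B n - Z" "x \<in> X" "d_connected B V Z q' x"
          by blast
        have qn: "(q, n) \<in> B" "(q', n) \<in> B" "q \<notin> Z" "q' \<notin> Z"
          using q(1,4) by (auto simp: parents_def)
        have "q \<in> V" "q' \<in> V"
          using q(1,4) pa n(2) by blast+
        then have "d_connected B V Z q' q"
          by (rule d_connected_common_child[OF qn(2,1) 4 qn(4,3) n(1), rotated])
        moreover have "has_descendant_in B Z q" "has_descendant_in B Z q'"
          using qn(1,2) 4 unfolding has_descendant_in_def by blast+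
        ultimately have "d_connected B V Z x y"
          using d_connected_trans[OF d_connected_trans[OF d_connected_sym[OF q(6)]] q(3)] by blast
        then show False
          using less.prems(7)[OF q(5,2)] by argo
      qed
      then show ?thesis
      proof
        assume *: "\<forall>q\<in>parents B n - Z. \<forall>y\<in>Y. \<not> d_connected B V Z q y"
        show ?thesis
          using 4
        proof (rule in_Z)
          show "\<not> d_connected B V Z q y" if "q \<in> parents B n - Z" "y \<in> Y" for q y
            using * that by blast
        qed (fact less.prems)+
      next
        assume *: "\<forall>q\<in>parents B n - Z. \<forall>x\<in>X. \<not> d_connected B V Z q x"
        have "indep_fac a Y Z X"
          using 4
        proof (rule in_Z)
          fix y x assume yx: "y \<in> Y" "x \<in> X"
          show "\<not> d_connected B V Z y x"
            using less.prems(7)[OF yx(2,1)] by (rule contrapos_nn) (rule d_connected_sym)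
        next
          show "\<not> d_connected B V Z q x" if "q \<in> parents B n - Z" "x \<in> X" for q x
            using * that by blast
        qed (use less.prems(3-6) in auto)
        then show ?thesis
          by (rule indep_fac_sym)
      qed
    qed
  qed
qed

end

end

section \<open>Minimal I-maps\<close>

context ordered_variables
begin

context
  fixes P :: "('v \<Rightarrow> 'b) pmf"
  assumes P_cases: "set_pmf P \<subseteq> cases"
begin

lemma prob_agree: "measure_pmf.prob P {c'. \<forall>i\<in>S. c' i = c i} = mass (pmf P) S c"
proof -
  have "measure_pmf.prob P {c'. \<forall>i\<in>S. c' i = c i} =
      measure_pmf.prob P {c' \<in> cases. \<forall>i\<in>S. c' i = c i}"
    by (rule measure_pmf.finite_measure_eq_AE) (use P_cases in \<open>auto simp: AE_measure_pmf_iff\<close>)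
  also have "\<dots> = mass (pmf P) S c"
    unfolding mass_def by (rule measure_measure_pmf_finite) (use finite_cases in simp)
  finally show ?thesis .
qed

lemma restrict_restrict_eq_iff: "restrict c' X = restrict c X \<longleftrightarrow> (\<forall>i\<in>X. c' i = c i)"
  by (auto simp: restrict_def fun_eq_iff)

lemma cond_indep_iff:
  assumes sub: "X \<union> Y \<union> Z \<subseteq> U" and disj: "X \<inter> Y = {}" "X \<inter> Z = {}" "Y \<inter> Z = {}"
  shows "cond_indep vals P X Z Y \<longleftrightarrow> (\<forall>c\<in>Pi U vals.
     mass (pmf P) (X \<union> Y \<union> Z) c / mass (pmf P) Z c =
     mass (pmf P) (X \<union> Z) c / mass (pmf P) Z c * (mass (pmf P) (Y \<union> Z) c / mass (pmf P) Z c))"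
    (is "_ \<longleftrightarrow> (\<forall>c\<in>_. ?eq c)")
proof -
  have probs:
    "\<P>(c' in measure_pmf P. restrict c' X = x \<and> restrict c' Y = y \<bar> restrict c' Z = z) =
       mass (pmf P) (X \<union> Y \<union> Z) c / mass (pmf P) Z c"
    "\<P>(c' in measure_pmf P. restrict c' X = x \<bar> restrict c' Z = z) =
       mass (pmf P) (X \<union> Z) c / mass (pmf P) Z c"
    "\<P>(c' in measure_pmf P. restrict c' Y = y \<bar> restrict c' Z = z) =
       mass (pmf P) (Y \<union> Z) c / mass (pmf P) Z c"
    if "x = restrict c X" "y = restrict c Y" "z = restrict c Z" for c x y z
    unfolding that restrict_restrict_eq_iff cond_prob_def prob_agree[symmetric]
    by (auto intro!: arg_cong2[where f="(/)"] arg_cong[where f="measure_pmf.prob P"])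
  show ?thesis
  proof
    assume ci: "cond_indep vals P X Z Y"
    show "\<forall>c\<in>Pi U vals. ?eq c"
    proof
      fix c assume "c \<in> Pi U vals"
      then have "restrict c X \<in> Pi\<^sub>E X vals" "restrict c Y \<in> Pi\<^sub>E Y vals" "restrict c Z \<in> Pi\<^sub>E Z vals"
        using sub by auto
      from ci[unfolded cond_indep_def, rule_format, OF this(1,3,2)] show "?eq c"
        unfolding probs[OF refl refl refl] .
    qed
  next
    assume eq: "\<forall>c\<in>Pi U vals. ?eq c"
    obtain d where d: "d \<in> cases"
      using P_cases set_pmf_not_empty[of P] by blast
    show "cond_indep vals P X Z Y"
      unfolding cond_indep_def
    proof (intro ballI)
      fix x y z assume xyz: "x \<in> Pi\<^sub>E X vals" "z \<in> Pi\<^sub>E Z vals" "y \<in> Pi\<^sub>E Y vals"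
      \<comment> \<open>The sets are disjoint, so the three instantiations glue together;
        \<open>d\<close> supplies the remaining coordinates.\<close>
      define c where "c i = (if i \<in> X then x i else if i \<in> Y then y i else if i \<in> Z then z i else d i)" for i
      have c: "c \<in> Pi U vals"
        using xyz d by (auto simp: c_def)
      have r: "x = restrict c X" "y = restrict c Y" "z = restrict c Z"
        using xyz disj by (auto simp: c_def PiE_def extensional_def restrict_def fun_eq_iff)
      show "\<P>(c' in measure_pmf P. restrict c' X = x \<and> restrict c' Y = y \<bar> restrict c' Z = z) =
        \<P>(c' in measure_pmf P. restrict c' X = x \<bar> restrict c' Z = z) *
        \<P>(c' in measure_pmf P. restrict c' Y = y \<bar> restrict c' Z = z)"
        unfolding probs[OF r] using eq c by blast
    qed
  qed
qed

context
  assumes P_pos: "\<And>c. c \<in> cases \<Longrightarrow> pmf P c > 0"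
begin

lemma I_map_if_locally_markov:
  assumes B: "network_structure U B" "obeys B ord" and lm: "locally_markov (pmf P) B"
  shows "I_map U vals P B"
  unfolding I_map_def
proof (intro allI impI, elim conjE)
  fix X Y Z assume sub: "X \<subseteq> U" "Y \<subseteq> U" "Z \<subseteq> U" and disj: "X \<inter> Y = {}" "X \<inter> Z = {}" "Y \<inter> Z = {}"
    and sep: "d_separated B X Z Y"
  have U: "X \<union> Y \<union> Z \<subseteq> U"
    using sub by auto
  have ind: "indep_fac (pmf P) X Z Y"
  proof (rule d_separation_sound[OF P_pos B lm subset_refl pred_subset U disj])
    fix x y assume "x \<in> X" "y \<in> Y"
    show "\<not> d_connected B U Z x y"
    proof
      assume "d_connected B U Z x y"
      then obtain p where p: "trail B p" "active B Z p" "hd p = x" "last p = y"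
        unfolding d_connected_def by blast
      then have "blocked B Z p"
        using sep \<open>x \<in> X\<close> \<open>y \<in> Y\<close> unfolding d_separated_def by blast
      then show False
        using active_not_blocked[OF p(2)] by simp
    qed
  qed
  show "cond_indep vals P X Z Y"
    unfolding cond_indep_iff[OF U disj]
  proof
    fix c assume c: "c \<in> Pi U vals"
    have "mass (pmf P) Z c > 0"
      by (rule mass_pos[OF P_pos c sub(3)])
    then show "mass (pmf P) (X \<union> Y \<union> Z) c / mass (pmf P) Z c =
     mass (pmf P) (X \<union> Z) c / mass (pmf P) Z c * (mass (pmf P) (Y \<union> Z) c / mass (pmf P) Z c)"
      using indep_fac_cross[OF ind disj U c] by (simp add: field_simps)
  qed
qed

text \<open>A trail that sets out along an arc moves later in the ordering as long as it follows
  arcs forwards. To end before \<open>x\<close> it has to turn, and where it first does there is a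
  head-to-head node after \<open>x\<close>.\<close>

lemma later_head_to_head:
  assumes "successively (\<lambda>x y. (x, y) \<in> B \<or> (y, x) \<in> B) (u # w # p)" "(u, w) \<in> B" "(x, w) \<in> ord"
    "obeys B ord" "(last (w # p), x) \<in> ord"
  shows "\<exists>e. head_to_head B (u # w # p) e \<and> (x, e) \<in> ord"
  using assms
proof (induction p arbitrary: u w)
  case Nil
  then show ?case using ord_asym by auto
next
  case (Cons r p)
  show ?case
  proof (cases "(r, w) \<in> B")
    case True
    have "head_to_head B (u # w # r # p) w"
      unfolding head_to_head_def
      by (rule exI[of _ "[]"], rule exI[of _ u], rule exI[of _ r], rule exI[of _ p])
         (use True Cons.prems(2) in simp)
    then show ?thesis
      using Cons.prems(3) by blast
  next
    case False
    then have "(w, r) \<in> B"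
      using Cons.prems(1) by simp
    moreover have "(x, r) \<in> ord"
      using calculation Cons.prems(3,4) ord_trans[of x w r] by (auto simp: obeys_def)
    ultimately obtain e where e: "head_to_head B (w # r # p) e" "(x, e) \<in> ord"
      using Cons.IH[of w r] Cons.prems by auto
    then obtain p1 l s p2 where d: "w # r # p = p1 @ [l, e, s] @ p2" "(l, e) \<in> B" "(s, e) \<in> B"
      unfolding head_to_head_def by blast
    have "head_to_head B (u # w # r # p) e"
      unfolding head_to_head_def
      by (rule exI[of _ "u # p1"], rule exI[of _ l], rule exI[of _ s], rule exI[of _ p2])
         (use d in simp)
    then show ?thesis
      using e(2) by blast
  qed
qed

text \<open>A trail that starts over a parent is blocked there. A trail that starts over a child has
  a head-to-head node after \<open>x\<close>; that node and its descendants come too late in the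
  ordering to be parents of \<open>x\<close>.\<close>

lemma d_separated_parents:
  assumes B: "network_structure U B" "obeys B ord"
  shows "d_separated B {x} (parents B x) (pred x - parents B x)"
  unfolding d_separated_def
proof (intro allI impI, elim conjE)
  fix p assume tr: "trail B p" and hl: "hd p \<in> {x}" "last p \<in> pred x - parents B x"
  obtain ps where ps: "p = x # ps"
    using tr hl by (cases p) (auto simp: trail_def)
  have "ps \<noteq> []"
    using hl(2) ps not_in_pred[of x] by auto
  then obtain z qs where p: "p = x # z # qs"
    using ps by (cases ps) auto
  have adj: "successively (\<lambda>x y. (x, y) \<in> B \<or> (y, x) \<in> B) (x # z # qs)" and dist: "distinct p"
    using tr p by (auto simp: trail_def)
  show "blocked B (parents B x) p"
  proof (cases "(z, x) \<in> B")
    case True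
    have "(x, z) \<notin> B"
      using True B(2) ord_asym unfolding obeys_def by blast
    \<comment> \<open>The nodes of a trail are distinct, so every triple centred at \<open>z\<close>
      begins with \<open>x\<close>; as \<open>x\<close> has no arc into \<open>z\<close>, the node
      \<open>z\<close> is not head-to-head.\<close>
    moreover have "l = x" if "p = p1 @ [l, z, r] @ p2" for p1 l r p2
    proof (cases p1)
      case Nil
      then show ?thesis using that p by simp
    next
      case (Cons k ks)
      then have "z # qs = ks @ [l, z, r] @ p2"
        using that p by simp
      then show ?thesis
        using dist p by (cases ks) auto
    qed
    ultimately have "\<not> head_to_head B p z"
      unfolding head_to_head_def by blast
    moreover have "z \<in> set p" "z \<in> parents B x"
      using p True by (auto simp: parents_def)
    ultimately show ?thesis
      unfolding blocked_def by blast
  next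
    case False
    then have xz: "(x, z) \<in> B"
      using adj by simp
    have "(x, z) \<in> ord"
      using xz B(2) unfolding obeys_def by blast
    moreover have "(last (z # qs), x) \<in> ord"
      using hl(2) p by (simp add: pred_def)
    ultimately obtain e where e: "head_to_head B p e" "(x, e) \<in> ord"
      using later_head_to_head[OF adj xz _ B(2)] p by blast
    have late: "d \<notin> parents B x" if "(x, d) \<in> ord" for d
      using parents_subset_pred[OF B, of x] ord_asym[OF that] by (auto simp: pred_def)
    have "d \<notin> parents B x" if "(e, d) \<in> B\<^sup>+" for d
      using late ord_trans[OF e(2) descendant_later[OF B(2) that]] by blast
    then show ?thesis
      unfolding blocked_def using e(1) late[OF e(2)] by blast
  qed
qed

lemma locally_markov_if_I_map:
  assumes B: "network_structure U B" "obeys B ord" and im: "I_map U vals P B"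
  shows "locally_markov (pmf P) B"
  unfolding locally_markov_def
proof (intro ballI)
  fix x c assume x: "x \<in> U" and c: "c \<in> Pi U vals"
  let ?Z = "parents B x" and ?Y = "pred x - parents B x"
  have pa: "?Z \<subseteq> pred x"
    by (rule parents_subset_pred[OF B])
  have sub: "{x} \<union> ?Y \<union> ?Z \<subseteq> U" and disj: "{x} \<inter> ?Y = {}" "{x} \<inter> ?Z = {}" "?Y \<inter> ?Z = {}"
    using pa pred_subset[of x] not_in_pred[of x] x by auto
  have "cond_indep vals P {x} ?Z ?Y"
    by (rule im[unfolded I_map_def, rule_format])
       (use d_separated_parents[OF B, of x] sub disj in blast)
  then have eq: "mass (pmf P) ({x} \<union> ?Y \<union> ?Z) c / mass (pmf P) ?Z c =
     mass (pmf P) ({x} \<union> ?Z) c / mass (pmf P) ?Z c * (mass (pmf P) (?Y \<union> ?Z) c / mass (pmf P) ?Z c)"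
    using cond_indep_iff[OF sub disj] c by blast
  have un: "{x} \<union> ?Y \<union> ?Z = insert x (pred x)" "?Y \<union> ?Z = pred x" "{x} \<union> ?Z = insert x ?Z"
    using pa by auto
  have "mass (pmf P) ?Z c > 0" "mass (pmf P) (pred x) c > 0"
    using mass_pos[OF P_pos c] pa pred_subset[of x] by auto
  then show "ratio (pmf P) x (pred x) c = ratio (pmf P) x ?Z c"
    using eq unfolding un ratio_def by (simp add: field_simps)
qed

text \<open>Summing out predecessors on which the conditional distribution does not depend leaves it
  unchanged. Deleting a parent is thereby reduced to asking which coordinates matter.\<close>

lemma ratio_parents_subset:
  assumes x: "x \<in> U" and S: "S \<subseteq> pred x" and c: "c \<in> Pi U vals"
    and dep: "\<And>c c'. c \<in> Pi U vals \<Longrightarrow> c' \<in> Pi U vals \<Longrightarrow> (\<And>i. i \<in> insert x S \<Longrightarrow> c i = c' i) \<Longrightarrow>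
       ratio (pmf P) x (pred x) c = ratio (pmf P) x (pred x) c'"
  shows "ratio (pmf P) x (pred x) c = ratio (pmf P) x S c"
proof -
  obtain d where d: "d \<in> cases"
    using P_cases set_pmf_not_empty[of P] by blast
  \<comment> \<open>Freezing the other coordinates at those of a fixed case makes the function
    depend on \<open>insert x S\<close> for all arguments, also outside \<open>Pi U vals\<close>, as
    \<open>mass_sub_factor\<close> requires.\<close>
  define g where "g c = ratio (pmf P) x (pred x) (\<lambda>i. if i \<in> insert x S then c i else d i)" for c
  have g: "depends_on g (insert x S)"
    unfolding depends_on_def
  proof (intro allI impI)
    fix c c' :: "'v \<Rightarrow> 'b" assume "\<forall>i\<in>insert x S. c i = c' i"
    then have "(\<lambda>i. if i \<in> insert x S then c i else d i) = (\<lambda>i. if i \<in> insert x S then c' i else d i)"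
      by (intro ext) auto
    then show "g c = g c'"
      by (simp add: g_def)
  qed
  have gr: "g c = ratio (pmf P) x (pred x) c" if "c \<in> Pi U vals" for c
    unfolding g_def by (rule dep) (use that d x in auto)
  have un: "S \<union> (pred x - S) = pred x"
    using S by auto
  have "\<forall>c\<in>Pi U vals. mass (pmf P) (insert x S) c = mass (pmf P) S c * g c"
  proof (rule mass_sub_factor[where R = "pred x - S"])
    show "finite (pred x - S)"
      using pred_subset[of x] finite_U finite_subset by blast
    show "\<forall>c\<in>Pi U vals. mass (pmf P) (insert x (S \<union> (pred x - S))) c =
        mass (pmf P) (S \<union> (pred x - S)) c * g c"
      unfolding un
    proof
      fix c assume c: "c \<in> Pi U vals"
      have "mass (pmf P) (pred x) c > 0"
        using mass_pos[OF P_pos c pred_subset] .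
      then show "mass (pmf P) (insert x (pred x)) c = mass (pmf P) (pred x) c * g c"
        unfolding gr[OF c] ratio_def by simp
    qed
  qed (use S g pred_subset[of x] not_in_pred[of x] in auto)
  then have "mass (pmf P) (insert x S) c = mass (pmf P) S c * ratio (pmf P) x (pred x) c"
    using c gr by simp
  moreover have "mass (pmf P) S c > 0"
    using mass_pos[OF P_pos c] S pred_subset[of x] by auto
  ultimately show ?thesis
    by (simp add: ratio_def)
qed

text \<open>The intersection property of positive distributions: a function on a product that depends
  only on the coordinates in \<open>S\<close> and only on those in \<open>T\<close> depends only on those in \<open>S \<inter> T\<close>.\<close>

lemma minimal_I_map_subset:
  assumes B: "network_structure U B" "obeys B ord" and min: "minimal_I_map U vals P B"
    and B': "network_structure U B'" "obeys B' ord" and lm': "locally_markov (pmf P) B'"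
  shows "B \<subseteq> B'"
proof (rule ccontr)
  assume "\<not> B \<subseteq> B'"
  then obtain y x where yx: "(y, x) \<in> B" "(y, x) \<notin> B'" by auto
  have lm: "locally_markov (pmf P) B"
    using locally_markov_if_I_map[OF B] min by (simp add: minimal_I_map_def)
  let ?B0 = "B - {(y, x)}"
  have B0: "network_structure U ?B0" "obeys ?B0 ord"
    using B by (auto simp: network_structure_def obeys_def intro: acyclic_subset)
  have "locally_markov (pmf P) ?B0"
    unfolding locally_markov_def
  proof (intro ballI)
    fix z c assume z: "z \<in> U" and c: "c \<in> Pi U vals"
    show "ratio (pmf P) z (pred z) c = ratio (pmf P) z (parents ?B0 z) c"
    proof (cases "z = x")
      case False
      then have "parents ?B0 z = parents B z"
        by (auto simp: parents_def)
      then show ?thesis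
        using lm z c by (simp add: locally_markov_def)
    next
      case True
      show ?thesis
      proof (rule ratio_parents_subset[OF z parents_subset_pred[OF B0] c])
        fix c c' assume c: "c \<in> Pi U vals" "c' \<in> Pi U vals"
          and agree: "\<And>i. i \<in> insert z (parents ?B0 z) \<Longrightarrow> c i = c' i"
        \<comment> \<open>The point between \<open>c\<close> and \<open>c'\<close>: the step from
          \<open>c\<close> to \<open>d\<close> is invisible to the family of \<open>z\<close> in
          \<open>B\<close>, and \<open>d\<close> differs from \<open>c'\<close> at most in
          \<open>y\<close>, which is not a parent of \<open>z\<close> in \<open>B'\<close>.
          Positivity makes the conditional distributions meaningful at \<open>d\<close>.\<close>
        define d where "d i = (if i \<in> insert z (parents B z) then c i else c' i)" for i
        have d: "d \<in> Pi U vals"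
          using c by (auto simp: d_def)
        have "ratio (pmf P) z (parents B z) c = ratio (pmf P) z (parents B z) d"
          by (rule depends_onD[OF depends_on_ratio]) (auto simp: d_def)
        moreover have "ratio (pmf P) z (parents B' z) d = ratio (pmf P) z (parents B' z) c'"
          by (rule depends_onD[OF depends_on_ratio])
             (use yx agree True in \<open>auto simp: d_def parents_def\<close>)
        ultimately show "ratio (pmf P) z (pred z) c = ratio (pmf P) z (pred z) c'"
          using lm lm' z c d by (simp add: locally_markov_def)
      qed
    qed
  qed
  then have "I_map U vals P ?B0"
    by (rule I_map_if_locally_markov[OF B0])
  then show False
    using min yx(1) by (auto simp: minimal_I_map_def)
qed

end

end

end

section \<open>Log-likelihood\<close>

context variables
begin

text \<open>For counts this is the maximal log-likelihood of the family of \<open>x\<close>; for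
  \<open>pmf P\<close> it is minus the conditional entropy of \<open>x\<close> given
  \<open>S\<close>.\<close>

definition loglik :: "(('v \<Rightarrow> 'b) \<Rightarrow> real) \<Rightarrow> 'v \<Rightarrow> 'v set \<Rightarrow> real" where
  "loglik a x S = (\<Sum>c\<in>cases. a c * log 2 (ratio a x S c))"

definition total_loglik :: "(('v \<Rightarrow> 'b) \<Rightarrow> real) \<Rightarrow> ('v \<times> 'v) set \<Rightarrow> real" where
  "total_loglik a B = (\<Sum>x\<in>U. loglik a x (parents B x))"

lemma cases_in_Pi: "c \<in> cases \<Longrightarrow> c \<in> Pi U vals"
  by auto

lemma ratio_pos:
  assumes "x \<in> U" "S \<subseteq> U" "c \<in> Pi U vals" "\<And>c. c \<in> cases \<Longrightarrow> a c > 0"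
  shows "ratio a x S c > 0"
  unfolding ratio_def using assms by (intro divide_pos_pos mass_pos) auto

section \<open>Gibbs' inequality\<close>

lemma log2_le: "y > 0 \<Longrightarrow> log 2 y \<le> (y - 1) / ln 2"
  unfolding log_def by (intro divide_right_mono ln_le_minus_one) auto

lemma log2_less: "y > 0 \<Longrightarrow> y \<noteq> 1 \<Longrightarrow> log 2 y < (y - 1) / ln 2"
  unfolding log_def using ln_le_minus_one[of y] ln_eq_minus_one[of y]
  by (intro divide_strict_right_mono) (auto simp: less_le)

context
  fixes x :: 'v and S and r a :: "('v \<Rightarrow> 'b) \<Rightarrow> real"
  assumes x: "x \<in> U" "S \<subseteq> U" "x \<notin> S"
    and r: "depends_on r (insert x S)" "\<And>c. c \<in> Pi U vals \<Longrightarrow> (\<Sum>v\<in>vals x. r (c(x := v))) = 1"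
      "\<And>c. c \<in> cases \<Longrightarrow> r c > 0"
    and a: "\<And>c. c \<in> cases \<Longrightarrow> a c > 0"
begin

lemma gibbs_terms:
  assumes "c \<in> cases"
  shows "r c / ratio a x S c > 0"
    "a c * log 2 (r c) - a c * log 2 (ratio a x S c) = a c * log 2 (r c / ratio a x S c)"
proof -
  have "ratio a x S c > 0"
    by (rule ratio_pos[OF x(1,2) cases_in_Pi[OF assms] a])
  then show "r c / ratio a x S c > 0"
    "a c * log 2 (r c) - a c * log 2 (ratio a x S c) = a c * log 2 (r c / ratio a x S c)"
    using r(3)[OF assms] by (simp_all add: log_divide algebra_simps)
qed

lemma gibbs_zero: "(\<Sum>c\<in>cases. a c * ((r c / ratio a x S c - 1) / ln 2)) = 0"
proof -
  have "(\<Sum>c\<in>cases. a c * (r c / ratio a x S c)) = sum a cases"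
    by (rule sum_reweighted[OF x r(1,2) a])
  then show ?thesis
    by (simp add: sum_divide_distrib[symmetric] sum_subtractf right_diff_distrib)
qed

lemma gibbs: "(\<Sum>c\<in>cases. a c * log 2 (r c)) \<le> loglik a x S"
proof -
  have "(\<Sum>c\<in>cases. a c * log 2 (r c)) - loglik a x S = (\<Sum>c\<in>cases. a c * log 2 (r c / ratio a x S c))"
    unfolding loglik_def sum_subtractf[symmetric] by (intro sum.cong refl gibbs_terms)
  also have "\<dots> \<le> (\<Sum>c\<in>cases. a c * ((r c / ratio a x S c - 1) / ln 2))"
    using gibbs_terms(1) a by (intro sum_mono mult_left_mono log2_le) (auto intro: less_imp_le)
  finally show ?thesis
    unfolding gibbs_zero by simp
qed

lemma gibbs_strict:
  assumes d: "d \<in> cases" "r d \<noteq> ratio a x S d"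
  shows "(\<Sum>c\<in>cases. a c * log 2 (r c)) < loglik a x S"
proof -
  have "(\<Sum>c\<in>cases. a c * log 2 (r c)) - loglik a x S = (\<Sum>c\<in>cases. a c * log 2 (r c / ratio a x S c))"
    unfolding loglik_def sum_subtractf[symmetric] by (intro sum.cong refl gibbs_terms)
  also have "\<dots> < (\<Sum>c\<in>cases. a c * ((r c / ratio a x S c - 1) / ln 2))"
  proof (rule sum_strict_mono_ex1[OF finite_cases])
    show "\<forall>c\<in>cases. a c * log 2 (r c / ratio a x S c) \<le> a c * ((r c / ratio a x S c - 1) / ln 2)"
      using gibbs_terms(1) a by (intro ballI mult_left_mono log2_le) (auto intro: less_imp_le)
    have "r d / ratio a x S d \<noteq> 1"
      using d(2) by simp
    then have "a d * log 2 (r d / ratio a x S d) < a d * ((r d / ratio a x S d - 1) / ln 2)"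
      using gibbs_terms(1)[OF d(1)] a[OF d(1)] by (intro mult_strict_left_mono log2_less)
    then show "\<exists>c\<in>cases. a c * log 2 (r c / ratio a x S c) < a c * ((r c / ratio a x S c - 1) / ln 2)"
      using d(1) by blast
  qed
  finally show ?thesis
    unfolding gibbs_zero by simp
qed

end

lemma loglik_family:
  assumes "x \<in> U" "S \<subseteq> U" "x \<notin> S"
  shows "loglik a x S = (\<Sum>w\<in>Pi\<^sub>E S vals. \<Sum>v\<in>vals x. mass a (insert x S) (w(x := v)) *
     log 2 (mass a (insert x S) (w(x := v)) / mass a S w))"
proof -
  have r: "ratio a x S c = mass a (insert x S) ((restrict c S)(x := c x)) / mass a S (restrict c S)" for c
    unfolding ratio_def by (intro arg_cong2[where f="(/)"] mass_cong) auto
  show ?thesis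
    unfolding loglik_def r
    by (rule sum_cases_family[OF assms, where f = "\<lambda>w v. log 2 (mass a (insert x S) (w(x := v)) / mass a S w)"])
qed

section \<open>Counts of a database as weights\<close>

definition cnt :: "('v \<Rightarrow> 'b) list \<Rightarrow> ('v \<Rightarrow> 'b) \<Rightarrow> real" where
  "cnt D c = real (length (filter (\<lambda>c'. c' = c) D))"

lemma mass_cnt:
  assumes "set D \<subseteq> cases"
  shows "mass (cnt D) S c = real (length (filter (\<lambda>c'. \<forall>i\<in>S. c' i = c i) D))"
  using assms
proof (induction D)
  case Nil
  then show ?case by (simp add: mass_def cnt_def)
next
  case (Cons d D)
  have "cnt (d # D) = (\<lambda>c. cnt D c + (if c = d then 1 else 0))"
    by (auto simp: cnt_def fun_eq_iff)
  then have "mass (cnt (d # D)) S c = mass (cnt D) S c + (\<Sum>c' | c' \<in> cases \<and> (\<forall>x\<in>S. c' x = c x). if c' = d then 1 else 0)"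
    by (simp add: mass_def sum.distrib)
  also have "(\<Sum>c' | c' \<in> cases \<and> (\<forall>x\<in>S. c' x = c x). if c' = d then 1 else 0::real) =
      (if \<forall>x\<in>S. d x = c x then 1 else 0)"
    using Cons.prems finite_cases by (subst sum.delta) auto
  finally show ?case
    using Cons by simp
qed

context
  fixes D :: "('v \<Rightarrow> 'b) list" and B :: "('v \<times> 'v) set" and x :: 'v
  assumes D: "set D \<subseteq> cases" and x: "x \<in> U" and pa: "parents B x \<subseteq> U" "x \<notin> parents B x"
begin

lemma N3_eq_mass:
  assumes "w \<in> Pi\<^sub>E (parents B x) vals"
  shows "real (N3 D B x w v) = mass (cnt D) (insert x (parents B x)) (w(x := v))"
proof -
  have "restrict c (parents B x) = w \<longleftrightarrow> (\<forall>i\<in>parents B x. c i = w i)" for c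
    using assms by (auto simp: PiE_def extensional_def restrict_def fun_eq_iff)
  then have "(c x = v \<and> restrict c (parents B x) = w) \<longleftrightarrow>
      (\<forall>i\<in>insert x (parents B x). c i = (w(x := v)) i)" for c
    using pa(2) by auto
  then show ?thesis
    unfolding N3_def mass_cnt[OF D] by presburger
qed

lemma N2_eq_mass:
  assumes "w \<in> Pi\<^sub>E (parents B x) vals"
  shows "real (N2 vals D B x w) = mass (cnt D) (parents B x) w"
  unfolding N2_def of_nat_sum N3_eq_mass[OF assms] by (rule mass_sum_value[OF x pa(2)])

lemma parent_insts_subset: "parent_insts D B x \<subseteq> Pi\<^sub>E (parents B x) vals"
proof -
  have "restrict c (parents B x) \<in> Pi\<^sub>E (parents B x) vals" if "c \<in> cases" for c
    using that pa(1) by auto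
  then show ?thesis
    using D unfolding parent_insts_def by blast
qed

lemma parent_insts_iff:
  assumes w: "w \<in> Pi\<^sub>E (parents B x) vals"
  shows "w \<in> parent_insts D B x \<longleftrightarrow> mass (cnt D) (parents B x) w > 0"
proof -
  have "restrict c (parents B x) = w \<longleftrightarrow> (\<forall>i\<in>parents B x. c i = w i)" for c
    using w by (auto simp: PiE_def extensional_def restrict_def fun_eq_iff)
  then show ?thesis
    unfolding mass_cnt[OF D] parent_insts_def
    by (auto simp: filter_empty_conv image_iff) metis
qed

text \<open>An instantiation of the parents that does not occur in the database has only zero
  counts, so summing over the occurring ones or over all of them is the same.\<close>

lemma sum_parent_insts:
  "(\<Sum>w\<in>parent_insts D B x. \<Sum>v\<in>vals x. real (N3 D B x w v) *
      log 2 (real (N3 D B x w v) / real (N2 vals D B x w))) = loglik (cnt D) x (parents B x)"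
proof -
  have fin: "finite (Pi\<^sub>E (parents B x) vals)"
    using pa finite_U finite_vals by (intro finite_PiE) (auto intro: finite_subset)
  have zero: "real (N3 D B x w v) = 0" if "w \<in> Pi\<^sub>E (parents B x) vals - parent_insts D B x" "v \<in> vals x" for w v
  proof -
    have "N2 vals D B x w = 0"
      using that parent_insts_iff[of w] N2_eq_mass[of w] by auto
    then show ?thesis
      using that(2) finite_vals[OF x] by (simp add: N2_def)
  qed
  have "(\<Sum>w\<in>parent_insts D B x. \<Sum>v\<in>vals x. real (N3 D B x w v) *
      log 2 (real (N3 D B x w v) / real (N2 vals D B x w))) =
     (\<Sum>w\<in>Pi\<^sub>E (parents B x) vals. \<Sum>v\<in>vals x. real (N3 D B x w v) *
      log 2 (real (N3 D B x w v) / real (N2 vals D B x w)))"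
    by (rule sum.mono_neutral_left[OF fin parent_insts_subset]) (auto simp: zero)
  also have "\<dots> = loglik (cnt D) x (parents B x)"
    unfolding loglik_family[OF x pa] by (intro sum.cong refl) (simp add: N3_eq_mass N2_eq_mass)
  finally show ?thesis .
qed

end

lemma cond_entropy_eq_loglik:
  assumes D: "set D \<subseteq> cases" "D \<noteq> []" and pa: "\<And>x. x \<in> U \<Longrightarrow> parents B x \<subseteq> U \<and> x \<notin> parents B x"
  shows "real (length D) * cond_entropy U vals B D = - total_loglik (cnt D) B"
proof -
  have "real (length D) * cond_entropy U vals B D = (\<Sum>x\<in>U. \<Sum>w\<in>parent_insts D B x. \<Sum>v\<in>vals x.
      - (real (N3 D B x w v) * log 2 (real (N3 D B x w v) / real (N2 vals D B x w))))"
    unfolding cond_entropy_def sum_distrib_left using D(2) by (intro sum.cong refl) simp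
  also have "\<dots> = - total_loglik (cnt D) B"
    unfolding total_loglik_def sum_negf using D pa by (intro arg_cong[where f=uminus] sum.cong refl) (auto simp: sum_parent_insts)
  finally show ?thesis .
qed

end

section \<open>Stirling's formula\<close>

text \<open>The increments of the error are \<open>O(1 / n^2)\<close>, hence summable, so the error
  converges and is bounded.\<close>

lemma ln_fact_bigo:
  "(\<lambda>n. ln (fact n) - ((real n + 1 / 2) * ln (real n) - real n)) \<in> O(\<lambda>_. 1)"
proof -
  define d where "d n = ln (fact n) - ((real n + 1 / 2) * ln (real n) - real n)" for n :: nat
  define e where "e n = ln (real n + 1) - ((real n + 3 / 2) * ln (real n + 1) - (real n + 1))
      + ((real n + 1 / 2) * ln (real n) - real n)" for n :: nat
  have "d (Suc n) - d n = e n" for n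
  proof -
    have "ln (fact (Suc n)) = ln (real n + 1) + ln (fact n)"
      unfolding fact_Suc of_nat_mult by (subst ln_mult) (auto simp: add.commute)
    then show ?thesis
      by (simp add: d_def e_def algebra_simps)
  qed
  moreover have "e \<in> O(\<lambda>n. 1 / real n ^ 2)"
    unfolding e_def by real_asymp
  then have "summable e"
    by (rule summable_comparison_test_bigo[rotated])
       (use inverse_power_summable[of 2, where ?'a=real] in \<open>simp add: inverse_eq_divide\<close>)
  ultimately have "summable (\<lambda>n. d (Suc n) - d n)"
    by simp
  then have "convergent (\<lambda>n. \<Sum>i<n. d (Suc i) - d i)"
    by (simp add: summable_iff_convergent)
  then obtain c where "(\<lambda>n. d n - d 0) \<longlonglongrightarrow> c"
    unfolding sum_lessThan_telescope convergent_def by blast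
  then have "(\<lambda>n. d n - d 0 + d 0) \<longlonglongrightarrow> c + d 0"
    by (intro tendsto_add tendsto_const)
  then have "d \<longlonglongrightarrow> c + d 0"
    by simp
  then have "d \<in> O(\<lambda>_. 1)"
    by (intro bigoI_tendsto[where c = "c + d 0"]) simp_all
  then show ?thesis
    unfolding d_def .
qed

lemma ln_fact_shift_bigo:
  "(\<lambda>n. ln (fact (n + m)) - ln (fact n) - real m * ln (real n)) \<in> O(\<lambda>_. 1)"
proof (induction m)
  case (Suc m)
  have eq: "ln (fact (n + Suc m)) - ln (fact n) - real (Suc m) * ln (real n) =
     (ln (fact (n + m)) - ln (fact n) - real m * ln (real n)) + (ln (real n + 1 + real m) - ln (real n))" for n
  proof -
    have "ln (fact (n + Suc m)) = ln (real n + 1 + real m) + ln (fact (n + m))"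
      unfolding add_Suc_right fact_Suc of_nat_mult by (subst ln_mult) (auto simp: algebra_simps)
    then show ?thesis
      by (simp add: algebra_simps)
  qed
  have "(\<lambda>n. ln (real n + 1 + real m) - ln (real n)) \<in> O(\<lambda>_. 1)"
    by real_asymp
  with Suc show ?case
    unfolding eq by (rule sum_in_bigo)
qed simp

text \<open>All counts will grow linearly, so each of their logarithms can be traded for
  \<open>ln N\<close> at bounded cost; this collects the logarithmic corrections into a single
  coefficient.\<close>

lemma ln_linear_bigo:
  fixes k :: "nat \<Rightarrow> nat"
  assumes "(\<lambda>N. real (k N) / real N) \<longlonglongrightarrow> q" "q > 0"
  shows "(\<lambda>N. ln (real (k N)) - ln (real N)) \<in> O(\<lambda>_. 1)" "filterlim k at_top sequentially"
proof -
  have "(\<lambda>N. ln (real (k N) / real N)) \<longlonglongrightarrow> ln q"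
    by (intro tendsto_ln assms) (use assms in auto)
  then have "(\<lambda>N. ln (real (k N) / real N)) \<in> O(\<lambda>_. 1)"
    by (intro bigoI_tendsto) auto
  moreover have "\<forall>\<^sub>F N in sequentially. ln (real (k N) / real N) = ln (real (k N)) - ln (real N)"
    using order_tendstoD(1)[OF assms] eventually_gt_at_top[of 0]
    by eventually_elim (auto simp: ln_div zero_less_divide_iff)
  ultimately show "(\<lambda>N. ln (real (k N)) - ln (real N)) \<in> O(\<lambda>_. 1)"
    by (subst (asm) landau_o.big.in_cong) auto
  have "filterlim (\<lambda>N. real (k N) / real N * real N) at_top sequentially"
    by (rule filterlim_tendsto_pos_mult_at_top[OF assms filterlim_real_sequentially])
  moreover have "\<forall>\<^sub>F N in sequentially. real (k N) / real N * real N = real (k N)"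
    using eventually_gt_at_top[of 0] by eventually_elim auto
  ultimately have "filterlim (\<lambda>N. real (k N)) at_top sequentially"
    by (subst (asm) filterlim_cong[OF refl refl]) 
  then show "filterlim k at_top sequentially"
    by (simp add: filterlim_sequentially_iff_filterlim_real)
qed

text \<open>The origin of half the number of parameters. Stirling's half logarithms contribute
  \<open>card V / 2\<close> from the counts and \<open>- 1 / 2\<close> from their total, the shift
  by \<open>card V - 1\<close> contributes \<open>- (card V - 1)\<close>; together
  \<open>- (card V - 1) / 2\<close> times \<open>ln N\<close>. The linear terms cancel since the
  counts add up to \<open>K N\<close>, and \<open>?R\<close> collects the bounded rest.\<close>

lemma dirichlet_factor_bigo:
  fixes k :: "'a \<Rightarrow> nat \<Rightarrow> nat" and V :: "'a set"
  assumes V: "finite V" "V \<noteq> {}"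
    and lim: "\<And>v. v \<in> V \<Longrightarrow> (\<lambda>N. real (k v N) / real N) \<longlonglongrightarrow> q v" and q: "\<And>v. v \<in> V \<Longrightarrow> q v > 0"
  defines "K \<equiv> \<lambda>N. \<Sum>v\<in>V. k v N"
  shows "(\<lambda>N. ln (fact (card V - 1) / fact (K N + card V - 1) * (\<Prod>v\<in>V. fact (k v N)))
      - ((\<Sum>v\<in>V. real (k v N) * ln (real (k v N) / real (K N))) - (real (card V) - 1) / 2 * ln (real N)))
      \<in> O(\<lambda>_. 1)"
proof -
  define m where "m = card V - 1"
  have m: "card V = Suc m"
    using V by (simp add: m_def card_gt_0_iff)
  have limK: "(\<lambda>N. real (K N) / real N) \<longlonglongrightarrow> (\<Sum>v\<in>V. q v)"
    unfolding K_def of_nat_sum sum_divide_distrib by (intro tendsto_sum lim)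
  have qK: "(\<Sum>v\<in>V. q v) > 0"
    by (intro sum_pos V q)
  define s where "s n = ln (fact n) - ((real n + 1 / 2) * ln (real n) - real n)" for n :: nat
  define t where "t n = ln (fact (n + m)) - ln (fact n) - real m * ln (real n)" for n :: nat
  have s: "s \<in> O(\<lambda>_. 1)" and t: "t \<in> O(\<lambda>_. 1)"
    unfolding s_def t_def by (rule ln_fact_bigo ln_fact_shift_bigo)+
  have sk: "(\<lambda>N. s (k v N)) \<in> O(\<lambda>_. 1)" if "v \<in> V" for v
    using landau_o.big.compose[OF s ln_linear_bigo(2)[OF lim[OF that] q[OF that]]] .
  have sK: "(\<lambda>N. s (K N)) \<in> O(\<lambda>_. 1)" "(\<lambda>N. t (K N)) \<in> O(\<lambda>_. 1)"
    using landau_o.big.compose[OF s ln_linear_bigo(2)[OF limK qK]]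
      landau_o.big.compose[OF t ln_linear_bigo(2)[OF limK qK]] .
  have lk: "(\<lambda>N. ln (real (k v N)) - ln (real N)) \<in> O(\<lambda>_. 1)" if "v \<in> V" for v
    by (rule ln_linear_bigo(1)[OF lim[OF that] q[OF that]])
  have lK: "(\<lambda>N. ln (real (K N)) - ln (real N)) \<in> O(\<lambda>_. 1)"
    by (rule ln_linear_bigo(1)[OF limK qK])
  let ?R = "\<lambda>N. ln (fact m) - t (K N) - s (K N) + (\<Sum>v\<in>V. s (k v N))
     + (1 / 2) * (\<Sum>v\<in>V. ln (real (k v N)) - ln (real N)) - (real m + 1 / 2) * (ln (real (K N)) - ln (real N))"
  have "?R \<in> O(\<lambda>_. 1)"
    by (intro sum_in_bigo big_sum_in_bigo sk sK lk lK landau_o.big.cmult_in_iff[THEN iffD2] | simp add: lk lK sk sK)+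
  moreover have "\<forall>\<^sub>F N in sequentially. ?R N =
      ln (fact (card V - 1) / fact (K N + card V - 1) * (\<Prod>v\<in>V. fact (k v N)))
      - ((\<Sum>v\<in>V. real (k v N) * ln (real (k v N) / real (K N))) - (real (card V) - 1) / 2 * ln (real N))"
  proof -
    have "\<forall>\<^sub>F N in sequentially. \<forall>v\<in>V. k v N > 0"
      using V(1) 
    proof (rule eventually_ball_finite, intro ballI)
      fix v assume "v \<in> V"
      show "\<forall>\<^sub>F N in sequentially. k v N > 0"
        using eventually_compose_filterlim[OF eventually_gt_at_top[of 0]
            ln_linear_bigo(2)[OF lim[OF \<open>v \<in> V\<close>] q[OF \<open>v \<in> V\<close>]]] .
    qed
    then show ?thesis
    proof eventually_elim
      case (elim N)
      have K: "K N > 0"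
        unfolding K_def using V elim by (intro sum_pos) auto
      have "ln (fact (card V - 1) / fact (K N + card V - 1) * (\<Prod>v\<in>V. fact (k v N)) :: real) =
          ln (fact m) - ln (fact (K N + m)) + (\<Sum>v\<in>V. ln (fact (k v N)))"
        using m V(1) by (simp add: ln_mult ln_div ln_prod prod_pos)
      also have "ln (fact (K N + m)) = t (K N) + s (K N) + (real (K N) + 1 / 2) * ln (real (K N)) - real (K N)
          + real m * ln (real (K N))"
        by (simp add: t_def s_def)
      also have "(\<Sum>v\<in>V. ln (fact (k v N) :: real)) = (\<Sum>v\<in>V. s (k v N) + real (k v N) * ln (real (k v N))
          + (1 / 2) * ln (real (k v N)) - real (k v N))"
        by (intro sum.cong) (auto simp: s_def algebra_simps)
      finally have L: "ln (fact (card V - 1) / fact (K N + card V - 1) * (\<Prod>v\<in>V. fact (k v N)) :: real) =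
          ln (fact m) - (t (K N) + s (K N) + (real (K N) + 1 / 2) * ln (real (K N)) - real (K N)
          + real m * ln (real (K N))) + ((\<Sum>v\<in>V. s (k v N)) + (\<Sum>v\<in>V. real (k v N) * ln (real (k v N)))
          + (1 / 2) * (\<Sum>v\<in>V. ln (real (k v N))) - real (K N))"
        by (simp add: sum.distrib sum_subtractf sum_distrib_left K_def)
      have "(\<Sum>v\<in>V. real (k v N) * ln (real (k v N) / real (K N))) =
          (\<Sum>v\<in>V. real (k v N) * ln (real (k v N)) - real (k v N) * ln (real (K N)))"
        using elim K by (intro sum.cong) (auto simp: ln_div algebra_simps)
      also have "\<dots> = (\<Sum>v\<in>V. real (k v N) * ln (real (k v N))) - real (K N) * ln (real (K N))"
        by (simp add: sum_subtractf sum_distrib_right[symmetric] K_def)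
      finally show ?case
        unfolding L using m by (simp add: sum_subtractf) (simp add: field_simps)
    qed
  qed
  ultimately show ?thesis
    by (subst (asm) landau_o.big.in_cong) auto
qed

section \<open>Asymptotics of the measures\<close>

context variables
begin

section \<open>Log-likelihoods along one fixed sequence of weights\<close>

context
  fixes p :: "('v \<Rightarrow> 'b) \<Rightarrow> real" and a :: "nat \<Rightarrow> ('v \<Rightarrow> 'b) \<Rightarrow> real"
  assumes p_pos: "\<And>c. c \<in> cases \<Longrightarrow> p c > 0"
    and dev: "\<And>c. c \<in> cases \<Longrightarrow> (\<lambda>N. a N c - real N * p c) \<in> o(\<lambda>N. sqrt (real N * ln (real N)))"
begin

lemma mass_dev: "(\<lambda>N. mass (a N) S c - real N * mass p S c) \<in> o(\<lambda>N. sqrt (real N * ln (real N)))"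
  unfolding mass_def sum_distrib_left sum_subtractf[symmetric]
  by (rule big_sum_in_smallo) (auto intro: dev)

lemma mass_limit: "(\<lambda>N. mass (a N) S c / real N) \<longlonglongrightarrow> mass p S c"
proof -
  have "(\<lambda>N. sqrt (real N * ln (real N))) \<in> o(\<lambda>N. real N)"
    by real_asymp
  then have "(\<lambda>N. mass (a N) S c - real N * mass p S c) \<in> o(\<lambda>N. real N)"
    using mass_dev landau_o.small.trans by blast
  then have "(\<lambda>N. (mass (a N) S c - real N * mass p S c) / real N) \<longlonglongrightarrow> 0"
    by (rule smalloD_tendsto)
  then have "(\<lambda>N. (mass (a N) S c - real N * mass p S c) / real N + mass p S c) \<longlonglongrightarrow> 0 + mass p S c"
    by (intro tendsto_add tendsto_const)
  moreover have "\<forall>\<^sub>F N in sequentially. (mass (a N) S c - real N * mass p S c) / real N + mass p S c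
      = mass (a N) S c / real N"
    using eventually_gt_at_top[of 0] by eventually_elim (simp add: field_simps)
  ultimately show ?thesis
    using Lim_transform_eventually by fastforce
qed

lemma weight_limit: "c \<in> cases \<Longrightarrow> (\<lambda>N. a N c / real N) \<longlonglongrightarrow> p c"
proof -
  assume c: "c \<in> cases"
  have "{c' \<in> cases. \<forall>x\<in>U. c' x = c x} = {c}"
    using c by (auto intro: PiE_ext)
  then show ?thesis
    using mass_limit[of U c] by (simp add: mass_def)
qed

lemma eventually_pos: "\<forall>\<^sub>F N in sequentially. \<forall>c\<in>cases. a N c > 0"
proof (rule eventually_ball_finite[OF finite_cases], intro ballI)
  fix c assume c: "c \<in> cases"
  show "\<forall>\<^sub>F N in sequentially. a N c > 0"
    using order_tendstoD(1)[OF weight_limit[OF c] p_pos[OF c]] eventually_gt_at_top[of 0]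
    by eventually_elim (auto simp: zero_less_divide_iff)
qed

lemma ratio_limit:
  assumes "x \<in> U" "S \<subseteq> U" "c \<in> Pi U vals"
  shows "(\<lambda>N. ratio (a N) x S c) \<longlonglongrightarrow> ratio p x S c"
proof -
  have "mass p S c > 0"
    by (rule mass_pos) (use p_pos assms in auto)
  then have "(\<lambda>N. (mass (a N) (insert x S) c / real N) / (mass (a N) S c / real N)) \<longlonglongrightarrow> ratio p x S c"
    unfolding ratio_def by (intro tendsto_divide mass_limit) auto
  moreover have "\<forall>\<^sub>F N in sequentially. (mass (a N) (insert x S) c / real N) / (mass (a N) S c / real N)
      = ratio (a N) x S c"
    using eventually_gt_at_top[of 0] by eventually_elim (simp add: ratio_def)
  ultimately show ?thesis
    by (rule Lim_transform_eventually)
qed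

lemma loglik_limit:
  assumes "x \<in> U" "S \<subseteq> U"
  shows "(\<lambda>N. loglik (a N) x S / real N) \<longlonglongrightarrow> loglik p x S"
proof -
  have "(\<lambda>N. (\<Sum>c\<in>cases. a N c / real N * log 2 (ratio (a N) x S c))) \<longlonglongrightarrow> loglik p x S"
    unfolding loglik_def
  proof (intro tendsto_sum tendsto_mult weight_limit)
    fix c assume c: "c \<in> cases"
    have "ratio p x S c > 0"
      by (rule ratio_pos[OF assms cases_in_Pi[OF c] p_pos])
    then show "(\<lambda>N. log 2 (ratio (a N) x S c)) \<longlonglongrightarrow> log 2 (ratio p x S c)"
      unfolding log_def using ratio_limit[OF assms cases_in_Pi[OF c]] by (auto intro!: tendsto_divide tendsto_ln)
  qed
  then show ?thesis
    by (simp add: loglik_def sum_divide_distrib)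
qed

text \<open>Gibbs' inequality for the observed weights: the true conditional distribution is one
  candidate in the maximisation of the likelihood.\<close>

lemma loglik_lower:
  assumes x: "x \<in> U" "S \<subseteq> U" "x \<notin> S"
  shows "\<forall>\<^sub>F N in sequentially. (\<Sum>c\<in>cases. a N c * log 2 (ratio p x S c)) \<le> loglik (a N) x S"
  using eventually_pos
proof eventually_elim
  case (elim N)
  show ?case
  proof (rule gibbs[OF x depends_on_ratio])
    show "(\<Sum>v\<in>vals x. ratio p x S (c(x := v))) = 1" if "c \<in> Pi U vals" for c
      by (rule sum_ratio[OF x that p_pos])
    show "ratio p x S c > 0" if "c \<in> cases" for c
      by (rule ratio_pos[OF x(1,2) cases_in_Pi[OF that] p_pos])
  qed (use elim in auto)
qed

lemma ratio_dev:
  assumes x: "x \<in> U" "S \<subseteq> U" and c: "c \<in> Pi U vals"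
  shows "(\<lambda>N. ratio (a N) x S c / ratio p x S c - 1) \<in> o(\<lambda>N. sqrt (real N * ln (real N)) / real N)"
proof -
  have pos: "mass p S c > 0" "mass p (insert x S) c > 0"
    by (rule mass_pos; use p_pos c x in blast)+
  \<comment> \<open>The two products \<open>real N * mass p _ c * mass p _ c\<close> cancel, so this
    is the cross difference whose quotient by the denominators is the relative error of
    \<open>ratio\<close>, written as a combination of deviations.\<close>
  let ?num = "\<lambda>N. (mass (a N) (insert x S) c - real N * mass p (insert x S) c) * mass p S c
      - (mass (a N) S c - real N * mass p S c) * mass p (insert x S) c"
  have num: "?num \<in> o(\<lambda>N. sqrt (real N * ln (real N)))"
    using pos by (intro sum_in_smallo) (auto intro!: mass_dev)
  have "(\<lambda>N. inverse (mass (a N) S c / real N * mass p (insert x S) c)) \<longlonglongrightarrow>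
      inverse (mass p S c * mass p (insert x S) c)"
    using pos by (intro tendsto_inverse tendsto_mult mass_limit tendsto_const) auto
  then have "(\<lambda>N. inverse (mass (a N) S c / real N * mass p (insert x S) c)) \<in> O(\<lambda>_. 1)"
    by (intro bigoI_tendsto) auto
  from landau_o.small_big_mult[OF num this]
  have "(\<lambda>N. ?num N * inverse (mass (a N) S c / real N * mass p (insert x S) c) / real N)
      \<in> o(\<lambda>N. sqrt (real N * ln (real N)) / real N)"
    by (intro landau_o.small.divide_right) (auto intro!: eventually_mono[OF eventually_gt_at_top[of 0]])
  moreover have "\<forall>\<^sub>F N in sequentially. ?num N * inverse (mass (a N) S c / real N * mass p (insert x S) c) / real N
      = ratio (a N) x S c / ratio p x S c - 1"
    using eventually_pos eventually_gt_at_top[of 0]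
  proof eventually_elim
    case (elim N)
    have "mass (a N) S c > 0"
      by (rule mass_pos) (use elim x c in auto)
    then show ?case
      using pos elim by (simp add: ratio_def field_simps)
  qed
  ultimately show ?thesis
    by (subst (asm) landau_o.small.in_cong) auto
qed

text \<open>With \<open>ln y \<le> y - 1\<close> the gain is at most
  \<open>\<Sum>c. a N c * (R N c - 1)\<close> up to the factor \<open>1 / ln 2\<close>. Replacing
  \<open>a N c\<close> by its mean \<open>N * p c\<close> makes the sum vanish, so only a deviation
  times a relative error remains: \<open>sqrt (N ln N)\<close> times
  \<open>sqrt (N ln N) / N\<close>, both in the little-o sense.\<close>

lemma loglik_upper:
  assumes x: "x \<in> U" "S \<subseteq> U" "x \<notin> S"
  obtains g where "g \<in> o(\<lambda>N. ln (real N))"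
    "\<forall>\<^sub>F N in sequentially. loglik (a N) x S \<le> (\<Sum>c\<in>cases. a N c * log 2 (ratio p x S c)) + g N"
proof
  define R where "R N c = ratio (a N) x S c / ratio p x S c" for N c
  define g where "g N = (\<Sum>c\<in>cases. (a N c - real N * p c) * (R N c - 1)) / ln 2" for N
  have "(\<lambda>N. \<Sum>c\<in>cases. (a N c - real N * p c) * (R N c - 1)) \<in> o(\<lambda>N. ln (real N))"
  proof (rule big_sum_in_smallo)
    fix c assume c: "c \<in> cases"
    have "(\<lambda>N. (a N c - real N * p c) * (R N c - 1)) \<in>
        o(\<lambda>N. sqrt (real N * ln (real N)) * (sqrt (real N * ln (real N)) / real N))"
      unfolding R_def by (intro landau_o.small_mult dev ratio_dev x(1,2) c cases_in_Pi)
    also have "(\<lambda>N. sqrt (real N * ln (real N)) * (sqrt (real N * ln (real N)) / real N)) \<in> O(\<lambda>N. ln (real N))"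
      by real_asymp
    finally show "(\<lambda>N. (a N c - real N * p c) * (R N c - 1)) \<in> o(\<lambda>N. ln (real N))" .
  qed
  then show "g \<in> o(\<lambda>N. ln (real N))"
    unfolding g_def by simp
  show "\<forall>\<^sub>F N in sequentially. loglik (a N) x S \<le> (\<Sum>c\<in>cases. a N c * log 2 (ratio p x S c)) + g N"
    using eventually_pos
  proof eventually_elim
    case (elim N)
    have aN: "\<And>c. c \<in> cases \<Longrightarrow> a N c > 0"
      using elim by blast
    have rp: "ratio p x S c > 0" "ratio (a N) x S c > 0" if "c \<in> cases" for c
      using ratio_pos[OF x(1,2) cases_in_Pi[OF that]] p_pos aN by blast+
    \<comment> \<open>The roles are exchanged with respect to Gibbs' inequality: \<open>p\<close> is
      the weight here, and the empirical conditional distribution is the one substituted.\<close>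
    have "(\<Sum>c\<in>cases. p c * (ratio (a N) x S c / ratio p x S c)) = sum p cases"
      by (rule sum_reweighted[OF x depends_on_ratio sum_ratio[OF x _ aN] p_pos])
    then have zero: "(\<Sum>c\<in>cases. p c * (R N c - 1)) = 0"
      by (simp add: R_def right_diff_distrib sum_subtractf)
    have "loglik (a N) x S - (\<Sum>c\<in>cases. a N c * log 2 (ratio p x S c)) = (\<Sum>c\<in>cases. a N c * log 2 (R N c))"
      unfolding loglik_def sum_subtractf[symmetric]
    proof (rule sum.cong[OF refl])
      fix c assume c: "c \<in> cases"
      show "a N c * log 2 (ratio (a N) x S c) - a N c * log 2 (ratio p x S c) = a N c * log 2 (R N c)"
        using rp[OF c] by (simp add: R_def log_divide algebra_simps)
    qed
    also have "\<dots> \<le> (\<Sum>c\<in>cases. a N c * ((R N c - 1) / ln 2))"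
    proof (rule sum_mono)
      fix c assume c: "c \<in> cases"
      show "a N c * log 2 (R N c) \<le> a N c * ((R N c - 1) / ln 2)"
        using rp[OF c] aN[OF c] by (intro mult_left_mono log2_le) (auto simp: R_def)
    qed
    also have "\<dots> = (\<Sum>c\<in>cases. (a N c - real N * p c) * (R N c - 1)) / ln 2
        + real N * (\<Sum>c\<in>cases. p c * (R N c - 1)) / ln 2"
      unfolding sum_distrib_left sum_divide_distrib sum.distrib[symmetric]
      by (intro sum.cong refl) (simp add: field_simps)
    also have "\<dots> = g N"
      by (simp add: zero g_def)
    finally show ?case by simp
  qed
qed

end

section \<open>Common expansion of the two measures\<close>

definition log_factor :: "('v \<Rightarrow> 'b) list \<Rightarrow> ('v \<times> 'v) set \<Rightarrow> 'v \<Rightarrow> ('v \<Rightarrow> 'b) \<Rightarrow> real" where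
  "log_factor D B x w = ln (fact (card (vals x) - 1) / fact (N2 vals D B x w + card (vals x) - 1) *
     (\<Prod>v\<in>vals x. fact (N3 D B x w v)))"

context
  fixes p :: "('v \<Rightarrow> 'b) \<Rightarrow> real" and D :: "nat \<Rightarrow> ('v \<Rightarrow> 'b) list"
  assumes p_pos: "\<And>c. c \<in> cases \<Longrightarrow> p c > 0" and cases_ne: "cases \<noteq> {}"
    and D: "\<And>N. set (D N) \<subseteq> cases" "\<And>N. length (D N) = N"
    and dev: "\<And>c. c \<in> cases \<Longrightarrow> (\<lambda>N. cnt (D N) c - real N * p c) \<in> o(\<lambda>N. sqrt (real N * ln (real N)))"
begin

lemma mass_pos_inst:
  assumes S: "S \<subseteq> U" and w: "\<And>i. i \<in> S \<Longrightarrow> w i \<in> vals i" and p: "\<And>c. c \<in> cases \<Longrightarrow> q c > 0"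
  shows "mass q S w > 0"
proof -
  obtain d where d: "d \<in> cases"
    using cases_ne by blast
  have "mass q S w = mass q S (\<lambda>i. if i \<in> S then w i else d i)"
    by (rule mass_cong) auto
  moreover have "mass q S (\<lambda>i. if i \<in> S then w i else d i) > 0"
    by (rule mass_pos) (use S w p d in auto)
  ultimately show ?thesis by simp
qed

lemma eventually_parent_insts:
  assumes x: "x \<in> U" and pa: "parents B x \<subseteq> U" "x \<notin> parents B x"
  shows "\<forall>\<^sub>F N in sequentially. parent_insts (D N) B x = Pi\<^sub>E (parents B x) vals"
proof -
  have "\<forall>\<^sub>F N in sequentially. \<forall>c\<in>cases. cnt (D N) c > 0"
    by (rule eventually_pos[OF p_pos dev])
  then show ?thesis
  proof eventually_elim
    case (elim N)
    have "mass (cnt (D N)) (parents B x) w > 0" if "w \<in> Pi\<^sub>E (parents B x) vals" for w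
      by (rule mass_pos_inst[OF pa(1)]) (use that elim in auto)
    then show ?case
      using parent_insts_iff[OF D(1) x pa] parent_insts_subset[OF D(1) x pa, of N] by blast
  qed
qed

lemma log_factor_bigo:
  assumes x: "x \<in> U" and pa: "parents B x \<subseteq> U" "x \<notin> parents B x" and w: "w \<in> Pi\<^sub>E (parents B x) vals"
  shows "(\<lambda>N. log_factor (D N) B x w - ((\<Sum>v\<in>vals x. real (N3 (D N) B x w v) *
      ln (real (N3 (D N) B x w v) / real (N2 vals (D N) B x w)))
      - (real (card (vals x)) - 1) / 2 * ln (real N))) \<in> O(\<lambda>_. 1)"
  unfolding log_factor_def N2_def
proof (rule dirichlet_factor_bigo[OF finite_vals[OF x]])
  show "vals x \<noteq> {}"
    using cases_ne x by (auto simp: PiE_eq_empty_iff)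
  fix v assume v: "v \<in> vals x"
  show "(\<lambda>N. real (N3 (D N) B x w v) / real N) \<longlonglongrightarrow> mass p (insert x (parents B x)) (w(x := v))"
    unfolding N3_eq_mass[OF D(1) x pa w] by (rule mass_limit[OF p_pos dev])
  show "mass p (insert x (parents B x)) (w(x := v)) > 0"
    by (rule mass_pos_inst) (use x pa w v p_pos in auto)
qed

lemma num_inst: "x \<in> U \<Longrightarrow> S \<subseteq> U \<Longrightarrow> card (Pi\<^sub>E S vals) = (\<Prod>y\<in>S. card (vals y))"
  by (rule card_PiE) (use finite_U in \<open>auto intro: finite_subset\<close>)

text \<open>Every instantiation of the parents eventually occurs, and their number is the product in
  \<open>num_params\<close>, so the corrections for the single instantiations add up to
  \<open>num_params / 2\<close> times the logarithm. The positive prior contributes a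
  constant.\<close>

lemma bayesian_expansion:
  assumes pa: "\<And>x. x \<in> U \<Longrightarrow> parents B x \<subseteq> U \<and> x \<notin> parents B x" and prior: "pmf prior B > 0"
    and vals: "\<And>x. x \<in> U \<Longrightarrow> card (vals x) \<ge> 1"
  shows "(\<lambda>N. bayesian_measure U vals prior B (D N) - (total_loglik (cnt (D N)) B
      - 1 / 2 * real (num_params U vals B) * log 2 (real N))) \<in> O(\<lambda>_. 1)"
proof -
  define T where "T N x w = (\<Sum>v\<in>vals x. real (N3 (D N) B x w v) *
      ln (real (N3 (D N) B x w v) / real (N2 vals (D N) B x w)))" for N x w
  let ?W = "\<lambda>x. Pi\<^sub>E (parents B x) vals"
  let ?R = "\<lambda>N. (ln (pmf prior B) + (\<Sum>x\<in>U. \<Sum>w\<in>?W x. log_factor (D N) B x w -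
      (T N x w - (real (card (vals x)) - 1) / 2 * ln (real N)))) / ln 2"
  have "(\<lambda>N. \<Sum>x\<in>U. \<Sum>w\<in>?W x. log_factor (D N) B x w -
      (T N x w - (real (card (vals x)) - 1) / 2 * ln (real N))) \<in> O(\<lambda>_. 1)"
    unfolding T_def by (intro big_sum_in_bigo log_factor_bigo) (use pa in auto)
  then have "(\<lambda>N. ln (pmf prior B) + (\<Sum>x\<in>U. \<Sum>w\<in>?W x. log_factor (D N) B x w -
      (T N x w - (real (card (vals x)) - 1) / 2 * ln (real N)))) \<in> O(\<lambda>_. 1)"
    by (intro sum_in_bigo) simp_all
  then have "?R \<in> O(\<lambda>_. 1)"
    by simp
  moreover have "\<forall>\<^sub>F N in sequentially. ?R N = bayesian_measure U vals prior B (D N) -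
      (total_loglik (cnt (D N)) B - 1 / 2 * real (num_params U vals B) * log 2 (real N))"
  proof -
    have "\<forall>\<^sub>F N in sequentially. \<forall>x\<in>U. parent_insts (D N) B x = ?W x"
      by (rule eventually_ball_finite[OF finite_U]) (use eventually_parent_insts pa in blast)
    then show ?thesis
    proof eventually_elim
      case (elim N)
      have fin: "finite (?W x)" if "x \<in> U" for x
        using pa[OF that] finite_U finite_vals by (intro finite_PiE) (auto intro: finite_subset)
      define h :: "'v \<Rightarrow> ('v \<Rightarrow> 'b) \<Rightarrow> real" where
        "h x w = fact (card (vals x) - 1) / fact (N2 vals (D N) B x w + card (vals x) - 1) *
          (\<Prod>v\<in>vals x. fact (N3 (D N) B x w v))" for x w
      have pos: "h x w > 0" for x w
        unfolding h_def by (intro mult_pos_pos divide_pos_pos prod_pos) auto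
      have pos': "(\<Prod>w\<in>?W x. h x w) > 0" for x
        by (intro prod_pos) (simp add: pos)
      have "ln (\<Prod>x\<in>U. \<Prod>w\<in>?W x. h x w) = (\<Sum>x\<in>U. ln (\<Prod>w\<in>?W x. h x w))"
        by (rule ln_prod[OF finite_U]) (use pos' in \<open>simp add: less_imp_neq[THEN not_sym]\<close>)
      also have "\<dots> = (\<Sum>x\<in>U. \<Sum>w\<in>?W x. log_factor (D N) B x w)"
        unfolding log_factor_def h_def[symmetric] by (intro sum.cong refl ln_prod fin) (use pos in \<open>simp_all add: less_imp_neq[THEN not_sym]\<close>)
      finally have "ln (pmf prior B * (\<Prod>x\<in>U. \<Prod>w\<in>?W x. h x w)) =
          ln (pmf prior B) + (\<Sum>x\<in>U. \<Sum>w\<in>?W x. log_factor (D N) B x w)"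
        using prior prod_pos[of U "\<lambda>x. \<Prod>w\<in>?W x. h x w"] pos' by (subst ln_mult_pos) auto
      moreover have "bayesian_measure U vals prior B (D N) =
          log 2 (pmf prior B * (\<Prod>x\<in>U. \<Prod>w\<in>?W x. h x w))"
        unfolding bayesian_measure_def h_def using elim by (simp cong: prod.cong)
      ultimately have "bayesian_measure U vals prior B (D N) =
          (ln (pmf prior B) + (\<Sum>x\<in>U. \<Sum>w\<in>?W x. log_factor (D N) B x w)) / ln 2"
        by (simp add: log_def)
      moreover have "total_loglik (cnt (D N)) B = (\<Sum>x\<in>U. \<Sum>w\<in>?W x. T N x w) / ln 2"
        unfolding total_loglik_def sum_divide_distrib
      proof (rule sum.cong[OF refl])
        fix x assume x: "x \<in> U"
        show "loglik (cnt (D N)) x (parents B x) = (\<Sum>w\<in>?W x. T N x w / ln 2)"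
          using sum_parent_insts[OF D(1) x, of B N] pa[OF x] elim x
          by (simp add: T_def log_def sum_divide_distrib)
      qed
      moreover have "real (num_params U vals B) * ln (real N) =
          (\<Sum>x\<in>U. \<Sum>w\<in>?W x. (real (card (vals x)) - 1) * ln (real N))"
      proof -
        have "real (num_params U vals B) = (\<Sum>x\<in>U. (real (card (vals x)) - 1) * real (card (?W x)))"
          unfolding num_params_def of_nat_sum
          by (intro sum.cong refl) (use vals pa num_inst in simp)
        then show ?thesis
          by (simp add: sum_distrib_left mult_ac)
      qed
      moreover have "(\<Sum>x\<in>U. \<Sum>w\<in>?W x. log_factor (D N) B x w -
           (T N x w - (real (card (vals x)) - 1) / 2 * ln (real N))) =
          (\<Sum>x\<in>U. \<Sum>w\<in>?W x. log_factor (D N) B x w) - (\<Sum>x\<in>U. \<Sum>w\<in>?W x. T N x w) +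
          1 / 2 * (\<Sum>x\<in>U. \<Sum>w\<in>?W x. (real (card (vals x)) - 1) * ln (real N))"
        unfolding sum_distrib_left sum_subtractf[symmetric] sum.distrib[symmetric]
        by (intro sum.cong refl) simp
      ultimately show ?case
        by (simp only: log_def) (simp add: field_simps)
    qed
  qed
  ultimately show ?thesis
    by (subst (asm) landau_o.big.in_cong) auto
qed

text \<open>For \<open>N > 0\<close> the error is exactly the constant
  \<open>log 2 (pmf prior B)\<close>.\<close>

lemma mdl_expansion:
  assumes pa: "\<And>x. x \<in> U \<Longrightarrow> parents B x \<subseteq> U \<and> x \<notin> parents B x"
  shows "(\<lambda>N. mdl_measure U vals prior B (D N) - (total_loglik (cnt (D N)) B
      - 1 / 2 * real (num_params U vals B) * log 2 (real N))) \<in> O(\<lambda>_. 1)"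
proof -
  have "\<forall>\<^sub>F N in sequentially. log 2 (pmf prior B) = mdl_measure U vals prior B (D N) -
      (total_loglik (cnt (D N)) B - 1 / 2 * real (num_params U vals B) * log 2 (real N))"
    using eventually_gt_at_top[of 0]
  proof eventually_elim
    case (elim N)
    then have "D N \<noteq> []"
      using D(2)[of N] by auto
    then show ?case
      using cond_entropy_eq_loglik[OF D(1) _ pa, of N] D(2)[of N] by (simp add: mdl_measure_def)
  qed
  moreover have "(\<lambda>_. log 2 (pmf prior B)) \<in> O(\<lambda>_::nat. 1)"
    by simp
  ultimately show ?thesis
    by (subst (asm) landau_o.big.in_cong) auto
qed

end

end

section \<open>Almost sure deviation bound\<close>

locale iid_pmf = prob_space \<Omega> for \<Omega> :: "'w measure" +
  fixes C :: "nat \<Rightarrow> 'w \<Rightarrow> 'c" and P :: "'c pmf"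
  assumes indep: "indep_vars (\<lambda>_. count_space UNIV) C UNIV"
    and distr: "distr \<Omega> (count_space UNIV) (C m) = measure_pmf P"
begin

lemma C_measurable [measurable]: "C m \<in> measurable \<Omega> (count_space UNIV)"
  using indep unfolding indep_vars_def by auto

lemma AE_in_set_pmf: "AE \<omega> in \<Omega>. \<forall>m. C m \<omega> \<in> set_pmf P"
proof -
  have "AE \<omega> in \<Omega>. C m \<omega> \<in> set_pmf P" for m
  proof -
    have "AE c in distr \<Omega> (count_space UNIV) (C m). c \<in> set_pmf P"
      unfolding distr by (simp add: AE_measure_pmf)
    then show ?thesis
      by (subst (asm) AE_distr_iff) auto
  qed
  then show ?thesis
    by (simp add: AE_all_countable)
qed

abbreviation ind :: "'c set \<Rightarrow> nat \<Rightarrow> 'w \<Rightarrow> real" where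
  "ind A m \<omega> \<equiv> indicator A (C m \<omega>)"

lemma expectation_ind: "expectation (ind A m) = measure_pmf.prob P A"
proof -
  have "measure_pmf.prob P A = (LINT c|distr \<Omega> (count_space UNIV) (C m). indicator A c)"
    unfolding distr by simp
  also have "\<dots> = expectation (ind A m)"
    by (rule integral_distr) auto
  finally show ?thesis by simp
qed

lemma hoeffding_ind:
  assumes "finite I" "I \<noteq> {}" "t \<ge> 0"
  shows "prob {\<omega> \<in> space \<Omega>. \<bar>\<Sum>i\<in>I. ind A i \<omega> - measure_pmf.prob P A\<bar> \<ge> t}
           \<le> 2 * exp (- 2 * t\<^sup>2 / real (card I))"
proof -
  have "indep_vars (\<lambda>_. borel) (\<lambda>m. ind A m) UNIV"
    by (rule indep_vars_compose2[OF indep, where Y="\<lambda>_. indicator A"]) auto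
  then have indI: "indep_vars (\<lambda>_. borel) (\<lambda>m. ind A m) I"
    by (rule indep_vars_subset) auto
  interpret Hoeffding_ineq \<Omega> I "\<lambda>m. ind A m" "\<lambda>_. 0" "\<lambda>_. 1" "\<Sum>i\<in>I. expectation (ind A i)"
    by unfold_locales (use assms(1) indI in \<open>auto simp: indicator_def\<close>)
  have "(\<Sum>i\<in>I. ((1::real) - 0)\<^sup>2) > 0"
    using assms by (simp add: card_gt_0_iff)
  from Hoeffding_ineq_abs_ge[OF assms(3) this] show ?thesis
    by (simp add: expectation_ind sum_subtractf)
qed

definition dev :: "'c set \<Rightarrow> 'w \<Rightarrow> nat \<Rightarrow> real" where
  "dev A \<omega> n = (\<Sum>i<n. ind A i \<omega> - measure_pmf.prob P A)"

lemma dev_diff: "m \<le> n \<Longrightarrow> dev A \<omega> n - dev A \<omega> m = (\<Sum>i\<in>{m..<n}. ind A i \<omega> - measure_pmf.prob P A)"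
  unfolding dev_def lessThan_atLeast0 by (rule sum_diff_nat_ivl) auto

lemma dev_measurable [measurable]: "(\<lambda>\<omega>. dev A \<omega> n) \<in> borel_measurable \<Omega>"
  unfolding dev_def
  by (intro borel_measurable_sum borel_measurable_diff borel_measurable_const
      measurable_compose[OF C_measurable]) simp

lemma hoeffding_dev_diff:
  assumes "m < n" "t \<ge> 0"
  shows "prob {\<omega> \<in> space \<Omega>. \<bar>dev A \<omega> n - dev A \<omega> m\<bar> \<ge> t} \<le> 2 * exp (- 2 * t\<^sup>2 / real (n - m))"
  using hoeffding_ind[of "{m..<n}" t A] assms by (simp add: dev_diff)

lemma dev_0 [simp]: "dev A \<omega> 0 = 0"
  by (simp add: dev_def)

text \<open>Hoeffding's bound at time \<open>n\<close> is \<open>2 * n powr (-2 * e^2)\<close>. For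
  small \<open>e\<close> it is not summable over all \<open>n\<close>, but along the times
  \<open>r ^ k\<close> it is dominated by a geometric series, whatever \<open>e\<close> is.\<close>

lemma AE_dev_blocks:
  fixes e :: real and r :: real
  assumes e: "e > 0" and r: "r > 1"
  shows "AE \<omega> in \<Omega>. \<forall>\<^sub>F k in sequentially. \<bar>dev A \<omega> (nat \<lceil>r ^ k\<rceil>)\<bar>
           < e * sqrt (nat \<lceil>r ^ k\<rceil> * ln (nat \<lceil>r ^ k\<rceil>))"
proof -
  define b where "b k = nat \<lceil>r ^ k\<rceil>" for k
  have b: "real (b k) \<ge> r ^ k" for k
    unfolding b_def by linarith
  have b1: "real (b k) \<ge> 1" for k
    using b[of k] one_le_power[of r k] r by linarith
  define bad where "bad k = {\<omega> \<in> space \<Omega>. \<bar>dev A \<omega> (b k) - dev A \<omega> 0\<bar> \<ge> e * sqrt (b k * ln (b k))}" for k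
  have [measurable]: "bad k \<in> sets \<Omega>" for k
    unfolding bad_def by measurable
  have bound: "prob (bad k) \<le> 2 * (r powr (-2 * e\<^sup>2)) ^ k" for k
  proof -
    have nn: "real (b k) * ln (b k) \<ge> 0"
      using b1[of k] by simp
    have "prob (bad k) \<le> 2 * exp (- 2 * (e * sqrt (b k * ln (b k)))\<^sup>2 / real (b k - 0))"
      unfolding bad_def by (rule hoeffding_dev_diff) (use b1[of k] nn e in auto)
    also have "(e * sqrt (b k * ln (b k)))\<^sup>2 = e\<^sup>2 * (b k * ln (b k))"
      using nn by (simp add: power_mult_distrib)
    also have "- 2 * (e\<^sup>2 * (b k * ln (b k))) / real (b k - 0) = - 2 * e\<^sup>2 * ln (b k)"
      using b1[of k] by simp
    also have "2 * exp (- 2 * e\<^sup>2 * ln (b k)) = 2 * b k powr (-2 * e\<^sup>2)"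
      using b1[of k] by (simp add: powr_def)
    also have "b k powr (-2 * e\<^sup>2) \<le> (r ^ k) powr (-2 * e\<^sup>2)"
      using b[of k] r by (intro powr_mono2') auto
    also have "(r ^ k) powr (-2 * e\<^sup>2) = (r powr (-2 * e\<^sup>2)) ^ k"
      using r by (simp add: powr_def ln_realpow exp_of_nat_mult [symmetric] algebra_simps)
    finally show ?thesis by simp
  qed
  have "summable (\<lambda>k. 2 * (r powr (-2 * e\<^sup>2)) ^ k)"
    by (intro summable_mult summable_geometric) (use r e in \<open>simp add: powr_less_one\<close>)
  then have "summable (\<lambda>k. prob (bad k))"
    by (rule summable_comparison_test_ev[rotated]) (use bound in auto)
  then have "AE \<omega> in \<Omega>. \<forall>\<^sub>F k in sequentially. \<omega> \<in> space \<Omega> - bad k"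
    by (intro borel_cantelli_AE1) (auto simp: emeasure_eq_measure)
  then show ?thesis
    by eventually_elim (auto elim!: eventually_mono simp: bad_def b_def not_le)
qed

text \<open>Within a block \<open>[b, (1 + e\<^sup>2) b)\<close> the plain union bound suffices: the increment from the start
  of the block has so few summands that Hoeffding's bound is \<open>2 / n\<^sup>2\<close>.\<close>

lemma AE_dev_within_block:
  fixes e :: real and b :: "nat \<Rightarrow> nat"
  assumes e: "e > 0" and b: "\<And>n. n \<ge> 1 \<Longrightarrow> b n \<le> n" "\<And>n. n \<ge> 1 \<Longrightarrow> real n - real (b n) \<le> e\<^sup>2 * n"
  shows "AE \<omega> in \<Omega>. \<forall>\<^sub>F n in sequentially. \<bar>dev A \<omega> n - dev A \<omega> (b n)\<bar> < e * sqrt (n * ln n)"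
proof -
  define bad where "bad n = {\<omega> \<in> space \<Omega>. \<bar>dev A \<omega> n - dev A \<omega> (b n)\<bar> \<ge> e * sqrt (n * ln n)}" for n
  have [measurable]: "bad k \<in> sets \<Omega>" for k
    unfolding bad_def by measurable
  have bound: "prob (bad n) \<le> 2 * real n powr (-2)" if n: "n \<ge> 2" for n
  proof (cases "b n < n")
    case True
    have nn: "real n * ln n \<ge> 0"
      using n by simp
    have "prob (bad n) \<le> 2 * exp (- 2 * (e * sqrt (n * ln n))\<^sup>2 / real (n - b n))"
      unfolding bad_def by (rule hoeffding_dev_diff) (use True nn e in auto)
    also have "(e * sqrt (n * ln n))\<^sup>2 = e\<^sup>2 * n * ln n"
      using nn by (simp add: power_mult_distrib)
    also have "- 2 * (e\<^sup>2 * n * ln n) / real (n - b n) \<le> - 2 * ln n"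
    proof -
      have "real (n - b n) \<le> e\<^sup>2 * n"
        using b(2)[of n] True n by simp
      then have "real (n - b n) * ln n \<le> e\<^sup>2 * n * ln n"
        using n by (intro mult_right_mono) auto
      then show ?thesis
        using True by (simp add: field_simps)
    qed
    also have "2 * exp (- 2 * ln n) = 2 * real n powr (-2)"
      using n by (simp add: powr_def)
    finally show ?thesis by simp
  next
    \<comment> \<open>At the start of a block the increment is zero, while \<open>n \<ge> 2\<close>
      makes the threshold positive.\<close>
    case False
    then have "b n = n"
      using b(1)[of n] n by simp
    then have "bad n = {}"
      using n e by (auto simp: bad_def not_le)
    then show ?thesis by simp
  qed
  have "summable (\<lambda>n. 2 * real n powr (-2))"
    by (intro summable_mult) (simp add: summable_real_powr_iff)
  then have "summable (\<lambda>k. prob (bad k))"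
    by (rule summable_comparison_test_ev[rotated])
       (use bound in \<open>auto simp: eventually_sequentially\<close>)
  then have "AE \<omega> in \<Omega>. \<forall>\<^sub>F k in sequentially. \<omega> \<in> space \<Omega> - bad k"
    by (intro borel_cantelli_AE1) (auto simp: emeasure_eq_measure)
  then show ?thesis
    by eventually_elim (auto elim!: eventually_mono simp: bad_def not_le)
qed

lemma block_index:
  fixes r :: real
  assumes r: "r > 1" and "n \<ge> 1"
  defines "k \<equiv> nat \<lfloor>log r (real n)\<rfloor>"
  shows "r ^ k \<le> n" "n < r ^ Suc k"
proof -
  have "log r n \<ge> 0"
    using assms by simp
  then have k: "real k \<le> log r n" "log r n < real k + 1"
    unfolding k_def by linarith+
  show "r ^ k \<le> n"
    using k(1) r \<open>n \<ge> 1\<close> by (simp add: le_log_iff powr_realpow)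
  have "n < r powr (real (Suc k))"
    using k(2) r \<open>n \<ge> 1\<close> by (subst (asm) log_less_iff) (auto simp: add.commute)
  then show "n < r ^ Suc k"
    using r by (subst (asm) powr_realpow) auto
qed

text \<open>One \<open>e\<close> pays for the deviation at the start of the block containing
  \<open>n\<close>, the other for the increment since then.\<close>

lemma AE_dev_bound:
  fixes e :: real
  assumes e: "e > 0"
  shows "AE \<omega> in \<Omega>. \<forall>\<^sub>F n in sequentially. \<bar>dev A \<omega> n\<bar> \<le> 2 * e * sqrt (n * ln n)"
proof -
  \<comment> \<open>With this ratio \<open>n\<close> exceeds the start of its block by at most
    \<open>r ^ Suc k - r ^ k = e\<^sup>2 * r ^ k \<le> e\<^sup>2 * n\<close>, the length that the
    increment bound tolerates.\<close>
  define r where "r = 1 + e\<^sup>2"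
  have r: "r > 1"
    using e by (simp add: r_def)
  define k where "k n = nat \<lfloor>log r (real n)\<rfloor>" for n :: nat
  define b where "b n = nat \<lceil>r ^ k n\<rceil>" for n
  have k: "r ^ k n \<le> n" "n < r ^ Suc (k n)" if "n \<ge> 1" for n
    using block_index[OF r that] by (auto simp: k_def)
  have b1: "b n \<le> n" if "n \<ge> 1" for n
    using k(1)[OF that] unfolding b_def by linarith
  have b2: "real n - real (b n) \<le> e\<^sup>2 * n" if "n \<ge> 1" for n
  proof -
    have "real (b n) \<ge> r ^ k n"
      unfolding b_def by linarith
    then have "real n - real (b n) \<le> r ^ Suc (k n) - r ^ k n"
      using k(2)[OF that] by linarith
    also have "\<dots> = e\<^sup>2 * r ^ k n"
      by (simp add: r_def algebra_simps)
    also have "\<dots> \<le> e\<^sup>2 * n"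
      using k(1)[OF that] by (intro mult_left_mono) auto
    finally show ?thesis .
  qed
  have b3: "b n \<ge> 1" for n
    unfolding b_def using one_le_power[of r "k n"] r by linarith
  have lim: "filterlim k at_top sequentially"
    unfolding k_def using r by real_asymp
  have "AE \<omega> in \<Omega>. \<forall>\<^sub>F n in sequentially. \<bar>dev A \<omega> n - dev A \<omega> (b n)\<bar> < e * sqrt (n * ln n)"
    by (rule AE_dev_within_block) (use e b1 b2 in auto)
  with AE_dev_blocks[OF e r, of A] show ?thesis
  proof eventually_elim
    case (elim \<omega>)
    have "\<forall>\<^sub>F n in sequentially. \<bar>dev A \<omega> (b n)\<bar> < e * sqrt (b n * ln (b n))"
      using eventually_compose_filterlim[OF elim(1) lim] by (simp add: b_def)
    with elim(2) eventually_ge_at_top[of 1] show ?case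
    proof eventually_elim
      case (elim n)
      have "real (b n) * ln (b n) \<le> real n * ln n"
        using b1[OF elim(2)] b3[of n] by (intro mult_mono) auto
      then have "e * sqrt (b n * ln (b n)) \<le> e * sqrt (n * ln n)"
        using e by simp
      with elim show ?case by linarith
    qed
  qed
qed

lemma AE_dev_smallo:
  "AE \<omega> in \<Omega>. dev A \<omega> \<in> o(\<lambda>n. sqrt (n * ln n))"
proof -
  \<comment> \<open>Only countably many constants, so that the exceptional sets still have a null
    union.\<close>
  have "AE \<omega> in \<Omega>. \<forall>i::nat. \<forall>\<^sub>F n in sequentially.
          \<bar>dev A \<omega> n\<bar> \<le> 2 * (1 / Suc i) * sqrt (n * ln n)"
    unfolding AE_all_countable by (intro allI AE_dev_bound) simp
  then show ?thesis
  proof eventually_elim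
    case (elim \<omega>)
    show ?case
    proof (rule landau_o.smallI)
      fix c :: real assume "c > 0"
      then obtain i where i: "1 / Suc i < c / 2"
        using nat_approx_posE[of "c / 2"] by auto
      from elim[rule_format, of i] show "\<forall>\<^sub>F n in sequentially. norm (dev A \<omega> n) \<le> c * norm (sqrt (n * ln n))"
      proof eventually_elim
        case (elim n)
        show ?case
        proof (cases "n = 0")
          case False
          then have "2 * (1 / Suc i) * sqrt (n * ln n) \<le> c * sqrt (n * ln n)"
            using i by (intro mult_right_mono) auto
          with elim False show ?thesis by simp
        qed simp
      qed
    qed
  qed
qed

end

section \<open>Comparison of structures\<close>

context ordered_variables
begin

lemma obeying_parents:
  assumes "network_structure U B" "obeys B ord"
  shows "parents B x \<subseteq> U \<and> x \<notin> parents B x"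
  using parents_subset_pred[OF assms, of x] pred_subset[of x] not_in_pred[of x] by blast

context
  fixes P :: "('v \<Rightarrow> 'b) pmf" and B B' :: "('v \<times> 'v) set" and D :: "nat \<Rightarrow> ('v \<Rightarrow> 'b) list"
  assumes vals2: "\<And>x. x \<in> U \<Longrightarrow> card (vals x) \<ge> 2"
    and P_cases: "set_pmf P \<subseteq> cases" and P_pos: "\<And>c. c \<in> cases \<Longrightarrow> pmf P c > 0"
    and B: "network_structure U B" "obeys B ord" "minimal_I_map U vals P B"
    and B': "network_structure U B'" "obeys B' ord" "B' \<noteq> B"
    and D: "\<And>N. set (D N) \<subseteq> cases" "\<And>N. length (D N) = N"
    and dev: "\<And>c. c \<in> cases \<Longrightarrow> (\<lambda>N. cnt (D N) c - real N * pmf P c) \<in> o(\<lambda>N. sqrt (real N * ln (real N)))"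
begin

lemma markov_B: "locally_markov (pmf P) B"
  using locally_markov_if_I_map[OF P_cases P_pos B(1,2)] B(3) by (simp add: minimal_I_map_def)

text \<open>The conditional distribution given \<open>S\<close> is a candidate for the one given all
  predecessors, so Gibbs' inequality applies to it, strictly as soon as the two differ at some
  case.\<close>

lemma loglik_le_pred:
  assumes x: "x \<in> U" and S: "S \<subseteq> pred x"
  shows "loglik (pmf P) x S \<le> loglik (pmf P) x (pred x)"
    "\<exists>c\<in>cases. ratio (pmf P) x S c \<noteq> ratio (pmf P) x (pred x) c \<Longrightarrow>
       loglik (pmf P) x S < loglik (pmf P) x (pred x)"
proof -
  have SU: "S \<subseteq> U" "x \<notin> S"
    using S pred_subset[of x] not_in_pred[of x] by auto
  have dep: "depends_on (ratio (pmf P) x S) (insert x (pred x))"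
    by (rule depends_on_mono[OF depends_on_ratio]) (use S in auto)
  note gibbs_hyps = x pred_subset not_in_pred dep sum_ratio[OF x SU _ P_pos]
    ratio_pos[OF x SU(1) cases_in_Pi P_pos] P_pos
  show "loglik (pmf P) x S \<le> loglik (pmf P) x (pred x)"
    unfolding loglik_def[of _ _ S] by (rule gibbs[OF gibbs_hyps])
  assume "\<exists>c\<in>cases. ratio (pmf P) x S c \<noteq> ratio (pmf P) x (pred x) c"
  then obtain c where c: "c \<in> cases" "ratio (pmf P) x S c \<noteq> ratio (pmf P) x (pred x) c"
    by blast
  show "loglik (pmf P) x S < loglik (pmf P) x (pred x)"
    unfolding loglik_def[of _ _ S] by (rule gibbs_strict[OF gibbs_hyps c])
qed

lemma markov_ratio:
  "locally_markov (pmf P) S \<Longrightarrow> x \<in> U \<Longrightarrow> c \<in> cases \<Longrightarrow>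
     ratio (pmf P) x (parents S x) c = ratio (pmf P) x (pred x) c"
  unfolding locally_markov_def by (drule bspec, assumption, drule bspec, erule cases_in_Pi) simp

lemma loglik_B: "x \<in> U \<Longrightarrow> loglik (pmf P) x (parents B x) = loglik (pmf P) x (pred x)"
  unfolding loglik_def by (intro sum.cong) (simp_all add: markov_ratio[OF markov_B])

lemma total_loglik_limit:
  assumes "network_structure U S" "obeys S ord"
  shows "(\<lambda>N. total_loglik (cnt (D N)) S / real N) \<longlonglongrightarrow> total_loglik (pmf P) S"
  unfolding total_loglik_def sum_divide_distrib
  by (intro tendsto_sum loglik_limit[OF P_pos dev]) (use obeying_parents[OF assms] in auto)

lemma total_loglik_not_markov:
  assumes "\<not> locally_markov (pmf P) B'"
  shows "total_loglik (pmf P) B' < total_loglik (pmf P) B"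
proof -
  note pa = parents_subset_pred[OF B'(1,2)]
  obtain x c where x: "x \<in> U" and c: "c \<in> Pi U vals"
    and ne: "ratio (pmf P) x (pred x) c \<noteq> ratio (pmf P) x (parents B' x) c"
    using assms by (auto simp: locally_markov_def)
  have agree: "ratio (pmf P) x S (restrict c U) = ratio (pmf P) x S c" if "S \<subseteq> U" for S
    by (rule depends_onD[OF depends_on_ratio]) (use that x in auto)
  have "restrict c U \<in> cases"
    using c by auto
  moreover have "ratio (pmf P) x (parents B' x) (restrict c U) \<noteq> ratio (pmf P) x (pred x) (restrict c U)"
    using ne agree[OF pred_subset] agree[of "parents B' x"] obeying_parents[OF B'(1,2), of x] by simp
  ultimately have "loglik (pmf P) x (parents B' x) < loglik (pmf P) x (pred x)"
    by (intro loglik_le_pred(2)[OF x pa] bexI)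
  then have "total_loglik (pmf P) B' < (\<Sum>x\<in>U. loglik (pmf P) x (pred x))"
    unfolding total_loglik_def
    by (intro sum_strict_mono_ex1 finite_U ballI bexI[OF _ x] loglik_le_pred(1)[OF _ pa])
  then show ?thesis
    by (simp add: total_loglik_def loglik_B)
qed

text \<open>Both structures are Markov, so the true distribution has the same likelihood
  \<open>?t\<close> in both. That common value is at most the maximum for \<open>B\<close> and falls
  short of the maximum for \<open>B'\<close> by at most \<open>o(ln N)\<close>.\<close>

lemma total_loglik_markov:
  assumes lm: "locally_markov (pmf P) B'"
  obtains g where "g \<in> o(\<lambda>N. ln (real N))" "\<forall>\<^sub>F N in sequentially. total_loglik (cnt (D N)) B' \<le> total_loglik (cnt (D N)) B + g N"
proof -
  let ?t = "\<lambda>N x. \<Sum>c\<in>cases. cnt (D N) c * log 2 (ratio (pmf P) x (pred x) c)"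
  have eq: "(\<Sum>c\<in>cases. cnt (D N) c * log 2 (ratio (pmf P) x (parents S x) c)) = ?t N x"
    if "locally_markov (pmf P) S" "x \<in> U" for S x N
    by (intro sum.cong) (simp_all add: markov_ratio[OF that])
  have "\<exists>g. g \<in> o(\<lambda>N. ln (real N)) \<and> (\<forall>\<^sub>F N in sequentially. loglik (cnt (D N)) x (parents B' x) \<le> ?t N x + g N)"
    if x: "x \<in> U" for x
  proof -
    have pa: "parents B' x \<subseteq> U" "x \<notin> parents B' x"
      using obeying_parents[OF B'(1,2)] by auto
    show ?thesis
      by (rule loglik_upper[OF P_pos dev x pa]) (auto simp: eq[OF lm x])
  qed
  then obtain g where g: "\<And>x. x \<in> U \<Longrightarrow> g x \<in> o(\<lambda>N. ln (real N))"
    "\<And>x. x \<in> U \<Longrightarrow> \<forall>\<^sub>F N in sequentially. loglik (cnt (D N)) x (parents B' x) \<le> ?t N x + g x N"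
    using bchoice[of U "\<lambda>x g. g \<in> o(\<lambda>N. ln (real N)) \<and>
        (\<forall>\<^sub>F N in sequentially. loglik (cnt (D N)) x (parents B' x) \<le> ?t N x + g N)"] by blast
  have low: "\<forall>\<^sub>F N in sequentially. ?t N x \<le> loglik (cnt (D N)) x (parents B x)" if x: "x \<in> U" for x
  proof -
    have pa: "parents B x \<subseteq> U" "x \<notin> parents B x"
      using obeying_parents[OF B(1,2)] by auto
    have "\<forall>\<^sub>F N in sequentially. (\<Sum>c\<in>cases. cnt (D N) c * log 2 (ratio (pmf P) x (parents B x) c))
        \<le> loglik (cnt (D N)) x (parents B x)"
      by (rule loglik_lower[OF P_pos dev x pa])
    then show ?thesis
      by (simp only: eq[OF markov_B x])
  qed
  show ?thesis
  proof (rule that[of "\<lambda>N. \<Sum>x\<in>U. g x N"])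
    show "(\<lambda>N. \<Sum>x\<in>U. g x N) \<in> o(\<lambda>N. ln (real N))"
      by (rule big_sum_in_smallo) (rule g)
    have "\<forall>\<^sub>F N in sequentially. \<forall>x\<in>U. loglik (cnt (D N)) x (parents B' x) \<le>
        loglik (cnt (D N)) x (parents B x) + g x N"
    proof (rule eventually_ball_finite[OF finite_U], intro ballI)
      fix x assume x: "x \<in> U"
      show "\<forall>\<^sub>F N in sequentially. loglik (cnt (D N)) x (parents B' x) \<le>
        loglik (cnt (D N)) x (parents B x) + g x N"
        using g(2)[OF x] low[OF x] by eventually_elim linarith
    qed
    then show "\<forall>\<^sub>F N in sequentially. total_loglik (cnt (D N)) B' \<le> total_loglik (cnt (D N)) B + (\<Sum>x\<in>U. g x N)"
      unfolding total_loglik_def sum.distrib[symmetric] by eventually_elim (auto intro: sum_mono)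
  qed
qed

text \<open>Every variable has at least two values, so an additional parent at least doubles the
  number of instantiations, and the factor \<open>card (vals x) - 1\<close> does not vanish.\<close>

lemma num_params_less:
  assumes "B \<subset> B'"
  shows "num_params U vals B < num_params U vals B'"
proof -
  have fin: "finite (parents B' x)" for x
    using obeying_parents[OF B'(1,2), of x] finite_U finite_subset by blast
  have sub: "parents B x \<subseteq> parents B' x" for x
    using assms by (auto simp: parents_def)
  have v: "card (vals y) \<ge> 2" if "y \<in> parents B' x" for x y
    using vals2 obeying_parents[OF B'(1,2), of x] that by blast
  have split: "(\<Prod>y\<in>parents B' x. card (vals y)) =
      (\<Prod>y\<in>parents B' x - parents B x. card (vals y)) * (\<Prod>y\<in>parents B x. card (vals y))" for x
    by (rule prod.subset_diff[OF sub fin])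
  have pos: "(\<Prod>y\<in>A. card (vals y)) > 0" if "A \<subseteq> parents B' x" for A x
  proof (rule prod_pos)
    fix y assume "y \<in> A"
    then show "0 < card (vals y)"
      using v[of y x] that by auto
  qed
  have le: "(\<Prod>y\<in>parents B x. card (vals y)) \<le> (\<Prod>y\<in>parents B' x. card (vals y))" for x
    unfolding split[of x] using pos[of "parents B' x - parents B x" x] by simp
  obtain y x where yx: "(y, x) \<in> B'" "(y, x) \<notin> B"
    using assms by auto
  then have y: "y \<in> parents B' x - parents B x" and x: "x \<in> U"
    using B'(1) by (auto simp: parents_def network_structure_def)
  have "(\<Prod>y\<in>parents B' x - parents B x. card (vals y)) =
      card (vals y) * (\<Prod>y\<in>parents B' x - parents B x - {y}. card (vals y))"
    using y fin by (intro prod.remove) auto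
  moreover have "(\<Prod>y\<in>parents B' x - parents B x - {y}. card (vals y)) \<ge> 1"
    using pos[of "parents B' x - parents B x - {y}" x] by force
  ultimately have "(\<Prod>y\<in>parents B' x - parents B x. card (vals y)) \<ge> 2 * 1"
    using v[of y x] y by (metis DiffD1 mult_le_mono)
  then have "(\<Prod>y\<in>parents B x. card (vals y)) < (\<Prod>y\<in>parents B' x. card (vals y))"
    unfolding split[of x] using pos[OF sub, of x] by simp
  then show ?thesis
    unfolding num_params_def using le x vals2[OF x] finite_U
    by (intro sum_strict_mono_ex1) (auto intro!: bexI[of _ x])
qed

lemma score_difference_at_top:
  assumes s: "(\<lambda>N. s N - (total_loglik (cnt (D N)) B - 1 / 2 * real (num_params U vals B) * log 2 (real N))) \<in> O(\<lambda>_. 1)"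
    "(\<lambda>N. s' N - (total_loglik (cnt (D N)) B' - 1 / 2 * real (num_params U vals B') * log 2 (real N))) \<in> O(\<lambda>_. 1)"
  shows "filterlim (\<lambda>N. s N - s' N) at_top sequentially"
proof -
  define k k' where "k = real (num_params U vals B)" and "k' = real (num_params U vals B')"
  define e where "e N = s N - (total_loglik (cnt (D N)) B - 1 / 2 * k * log 2 (real N)) -
      (s' N - (total_loglik (cnt (D N)) B' - 1 / 2 * k' * log 2 (real N)))" for N
  have e: "e \<in> O(\<lambda>_. 1)"
    unfolding e_def k_def k'_def by (intro sum_in_bigo s)
  have diff: "s N - s' N = total_loglik (cnt (D N)) B - total_loglik (cnt (D N)) B' + 1 / 2 * (k' - k) * log 2 (real N) + e N" for N
    by (simp add: e_def field_simps)
  show ?thesis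
  proof (cases "locally_markov (pmf P) B'")
    case False
    \<comment> \<open>Here \<open>k' - k\<close> may have either sign: the competitor may well have
      fewer parameters. A positive \<open>\<delta>\<close> yields a linear advantage, against which
      the logarithmic terms are negligible.\<close>
    define \<delta> where "\<delta> = total_loglik (pmf P) B - total_loglik (pmf P) B'"
    have "\<delta> > 0"
      using total_loglik_not_markov[OF False] by (simp add: \<delta>_def)
    have "(\<lambda>N. total_loglik (cnt (D N)) B / real N - total_loglik (cnt (D N)) B' / real N) \<longlonglongrightarrow> \<delta>"
      unfolding \<delta>_def by (intro tendsto_diff total_loglik_limit B B')
    moreover have "(\<lambda>N. (1 / 2 * (k' - k) * log 2 (real N) + e N) / real N) \<longlonglongrightarrow> 0"
    proof (rule smalloD_tendsto, rule sum_in_smallo)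
      have "(\<lambda>N. log 2 (real N)) \<in> o(\<lambda>N. real N)"
        by real_asymp
      then show "(\<lambda>N. 1 / 2 * (k' - k) * log 2 (real N)) \<in> o(\<lambda>N. real N)"
        by (cases "k' = k") simp_all
      have "(\<lambda>_. 1) \<in> o(\<lambda>N. real N)"
        by real_asymp
      with e show "e \<in> o(\<lambda>N. real N)"
        by (rule landau_o.big_small_trans)
    qed
    ultimately have "(\<lambda>N. total_loglik (cnt (D N)) B / real N - total_loglik (cnt (D N)) B' / real N +
        (1 / 2 * (k' - k) * log 2 (real N) + e N) / real N) \<longlonglongrightarrow> \<delta> + 0"
      by (rule tendsto_add)
    moreover have "total_loglik (cnt (D N)) B / real N - total_loglik (cnt (D N)) B' / real N +
        (1 / 2 * (k' - k) * log 2 (real N) + e N) / real N = (s N - s' N) / real N" for N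
      unfolding diff by (simp add: add_divide_distrib diff_divide_distrib)
    ultimately have "(\<lambda>N. (s N - s' N) / real N) \<longlonglongrightarrow> \<delta>"
      by simp
    then have "filterlim (\<lambda>N. (s N - s' N) / real N * real N) at_top sequentially"
      by (rule filterlim_tendsto_pos_mult_at_top[OF _ \<open>\<delta> > 0\<close> filterlim_real_sequentially])
    moreover have "\<forall>\<^sub>F N in sequentially. (s N - s' N) / real N * real N = s N - s' N"
      using eventually_gt_at_top[of 0] by eventually_elim simp
    ultimately show ?thesis
      by (rule filterlim_cong[OF refl refl, THEN iffD1, rotated])
  next
    case True
    then have "B \<subset> B'"
      using minimal_I_map_subset[OF P_cases P_pos B B'(1,2) True] B'(3) by blast
    then have k: "k < k'"
      using num_params_less by (simp add: k_def k'_def)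
    obtain g where g: "g \<in> o(\<lambda>N. ln (real N))" "\<forall>\<^sub>F N in sequentially. total_loglik (cnt (D N)) B' \<le> total_loglik (cnt (D N)) B + g N"
      using total_loglik_markov[OF True] by blast
    define h where "h N = e N - g N" for N
    \<comment> \<open>Half the number of surplus parameters, with \<open>ln 2\<close> converting
      from binary to natural logarithms.\<close>
    define \<kappa> where "\<kappa> = (k' - k) / (2 * ln 2)"
    have "\<kappa> > 0"
      using k by (simp add: \<kappa>_def)
    have "h \<in> o(\<lambda>N. ln (real N))"
      unfolding h_def
    proof (intro sum_in_smallo g)
      have "(\<lambda>_::nat. 1) \<in> o(\<lambda>N. ln (real N))"
        by real_asymp
      with e show "e \<in> o(\<lambda>N. ln (real N))"
        by (rule landau_o.big_small_trans)
    qed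
    then have "(\<lambda>N. h N / ln (real N)) \<longlonglongrightarrow> 0"
      by (rule smalloD_tendsto)
    then have "(\<lambda>N. \<kappa> + h N / ln (real N)) \<longlonglongrightarrow> \<kappa> + 0"
      by (intro tendsto_add tendsto_const)
    then have lim: "(\<lambda>N. \<kappa> + h N / ln (real N)) \<longlonglongrightarrow> \<kappa>"
      by simp
    have "filterlim (\<lambda>N::nat. ln (real N)) at_top sequentially"
      by real_asymp
    from filterlim_tendsto_pos_mult_at_top[OF lim \<open>\<kappa> > 0\<close> this]
    show ?thesis
    proof (rule filterlim_at_top_mono)
      show "\<forall>\<^sub>F N in sequentially. (\<kappa> + h N / ln (real N)) * ln (real N) \<le> s N - s' N"
        using g(2) eventually_gt_at_top[of 1]
      proof eventually_elim
        case (elim N)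
        have "(\<kappa> + h N / ln (real N)) * ln (real N) = 1 / 2 * (k' - k) * log 2 (real N) + e N - g N"
          using elim by (simp add: \<kappa>_def h_def log_def field_simps)
        then show ?case
          using elim unfolding diff by linarith
      qed
    qed
  qed
qed

end

end

lemma (in variables) cnt_map: "cnt (map f [0..<N]) c = (\<Sum>m<N. indicator {c} (f m))"
proof (induction N)
  case 0
  then show ?case by (simp add: cnt_def)
next
  case (Suc N)
  then show ?case by (simp add: cnt_def)
qed

text \<open>That one structure is overwhelmingly preferred in large databases is read as follows:
  along almost every infinite sequence of independent cases, with the first \<open>N\<close> cases
  as database, the difference of the measures tends to infinity. The measure of a structure of prior
  probability zero would involve \<open>log 0\<close>, hence the positive priors.\<close>

theorem theorem3p1:
  fixes U :: "'v set" and vals :: "'v \<Rightarrow> 'b set"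
    and P :: "('v \<Rightarrow> 'b) pmf"
    and \<Omega> :: "'w measure" and C :: "nat \<Rightarrow> 'w \<Rightarrow> 'v \<Rightarrow> 'b"
    and ord BS :: "('v \<times> 'v) set"
    and prior :: "('v \<times> 'v) set pmf"
    and score :: "('v \<times> 'v) set \<Rightarrow> ('v \<Rightarrow> 'b) list \<Rightarrow> real"
  assumes "finite U"
    and "\<forall>x\<in>U. finite (vals x) \<and> card (vals x) \<ge> 2"
    and "set_pmf P \<subseteq> Pi\<^sub>E U vals"
    and "\<forall>c\<in>Pi\<^sub>E U vals. pmf P c > 0"
    and "prob_space \<Omega>"
    and "prob_space.indep_vars \<Omega> (\<lambda>_. count_space UNIV) C UNIV"
    and "\<forall>m. distr \<Omega> (count_space UNIV) (C m) = measure_pmf P"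
    and "strict_linear_order_on U ord"
    and "network_structure U BS" and "obeys BS ord" and "minimal_I_map U vals P BS"
    and "pmf prior BS > 0"
    and "score \<in> {bayesian_measure U vals prior, mdl_measure U vals prior}"
  shows "AE \<omega> in \<Omega>. \<forall>BS'. network_structure U BS' \<and> obeys BS' ord \<and> BS' \<noteq> BS \<and> pmf prior BS' > 0 \<longrightarrow>
           filterlim (\<lambda>N. score BS (map (\<lambda>m. C m \<omega>) [0..<N]) - score BS' (map (\<lambda>m. C m \<omega>) [0..<N]))
             at_top sequentially"
proof -
  interpret prob_space \<Omega> by fact
  interpret iid_pmf \<Omega> C P
    by unfold_locales (use assms in auto)
  interpret ordered_variables U vals ord
    by unfold_locales (use assms in auto)
  have vals2: "\<And>x. x \<in> U \<Longrightarrow> card (vals x) \<ge> 2" and P_pos: "\<And>c. c \<in> cases \<Longrightarrow> pmf P c > 0"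
    using assms(2,4) by auto
  have ne: "cases \<noteq> {}"
    using assms(3) set_pmf_not_empty[of P] by blast
  \<comment> \<open>The databases matter only through the counts of finitely many cases. One null
    set thus serves all structures, and the competitor can be chosen after
    \<open>\<omega>\<close>.\<close>
  have "AE \<omega> in \<Omega>. \<forall>c\<in>cases. dev {c} \<omega> \<in> o(\<lambda>n. sqrt (n * ln n))"
    by (rule AE_finite_allI[OF finite_cases AE_dev_smallo])
  with AE_in_set_pmf show ?thesis
  proof eventually_elim
    case (elim \<omega>)
    define D where "D N = map (\<lambda>m. C m \<omega>) [0..<N]" for N
    have D: "set (D N) \<subseteq> cases" "length (D N) = N" for N
      using elim(1) assms(3) by (auto simp: D_def)
    have dev: "(\<lambda>N. cnt (D N) c - real N * pmf P c) \<in> o(\<lambda>N. sqrt (real N * ln (real N)))"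
      if c: "c \<in> cases" for c
    proof -
      have "(\<lambda>N. cnt (D N) c - real N * pmf P c) = dev {c} \<omega>"
        by (simp add: fun_eq_iff D_def cnt_map dev_def sum_subtractf measure_pmf_single)
      then show ?thesis
        using elim(2) c by simp
    qed
    have expansion: "(\<lambda>N. score B (D N) - (total_loglik (cnt (D N)) B - 1 / 2 * real (num_params U vals B) * log 2 (real N))) \<in> O(\<lambda>_. 1)"
      if B: "network_structure U B" "obeys B ord" "pmf prior B > 0" for B
    proof -
      have vals1: "card (vals x) \<ge> 1" if "x \<in> U" for x
        using vals2[OF that] by simp
      note pa = obeying_parents[OF B(1,2)]
      from assms(13) consider "score = bayesian_measure U vals prior" | "score = mdl_measure U vals prior"
        by blast
      then show ?thesis
      proof cases
        case 1
        show ?thesis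
          unfolding 1 by (rule bayesian_expansion[OF P_pos ne D dev pa B(3) vals1])
      next
        case 2
        show ?thesis
          unfolding 2 by (rule mdl_expansion[OF P_pos ne D dev pa])
      qed
    qed
    show ?case
      unfolding D_def[symmetric]
    proof (intro allI impI, elim conjE)
      fix B assume B: "network_structure U B" "obeys B ord" "B \<noteq> BS" "pmf prior B > 0"
      show "filterlim (\<lambda>N. score BS (D N) - score B (D N)) at_top sequentially"
      proof (rule score_difference_at_top[OF vals2 assms(3) P_pos assms(9-11) B(1-3) D dev])
        show "(\<lambda>N. score BS (D N) - (total_loglik (cnt (D N)) BS - 1 / 2 * real (num_params U vals BS) * log 2 (real N))) \<in> O(\<lambda>_. 1)"
          by (rule expansion[OF assms(9,10,12)])
        show "(\<lambda>N. score B (D N) - (total_loglik (cnt (D N)) B - 1 / 2 * real (num_params U vals B) * log 2 (real N))) \<in> O(\<lambda>_. 1)"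
          by (rule expansion[OF B(1,2,4)])
      qed
    qed
  qed
qed

end
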